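(* Let $\Omega, f, g, q, W, R, A, Q, V, p$ be as in the context (in particular conditions $(C_1)$, $(C_2)$ and the semiglobal standing assumption hold), and let $P$ be the stabilizing solution of the Riccati equation $PA+A^TP-PR(0)P+Q=0$. Let $\gamma_0>0$ be a fixed constant and let $\Psi\subset\Omega$ be any compact set. Then there is a constant $C>0$ depending only on $f,g,R,p,W$ such that for any $\varepsilon\in(0,\gamma_0)$ there exist $\delta>0$ and $\eta>0$ with the following property. Suppose that $p^{NN}(\theta,\cdot):\Omega\to\mathbb R^n$ is a locally Lipschitz map (a neural network with parameters $\theta$) satisfying (a) $|p^{NN}(\theta,x)-p(x)|<\delta$ for all $x\in\Omega$; (b) $|p^{NN}(\theta,x)-Px|\le\eta|x|$ for all $x\in\Omega$ with $|x|<\gamma_0$. Let $x_0\in\Psi$ be arbitrary, let $x(t)$ be the solution of $\dot x=f(x)-R(x)p(x)$, $x(0)=x_0$, and let $x^{NN}(t)$ be the solution of $\dot x=f(x)-R(x)p^{NN}(\theta,x)$, $x(0)=x_0$. Then $|x^{NN}(t)-x(t)|<\varepsilon$ for all $t>0$ (in particular $x^{NN}(t)$ exists for all $t\ge 0$), and both $x^{NN}(t)$ and $x(t)$ decay exponentially to $0$ as $t\to+\infty$. Consequently, $$|J(x^{NN},u^{NN})-J(x,u)|<C\varepsilon,$$ where $u=-W^{-1}g(x)^Tp(x)$ is evaluated along $x(t)$ and $u^{NN}=-W^{-1}g(x^{NN})^Tp^{NN}(\theta,x^{NN})$ is evaluated along $x^{NN}(t)$.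
   Context: Setting. $\Omega\subset\mathbb R^n$ is a bounded domain with piecewise smooth boundary containing $0$. Consider the control system $\dot x=f(x)+g(x)u$ in $\Omega$, with control $u\in\mathbb R^m$, and the cost functional $$J(x,u)=\int_0^{+\infty}\Big(q(x(t))+\tfrac12u(t)^TWu(t)\Big)dt,$$ where $W$ is a symmetric positive definite $m\times m$ matrix and $q\ge0$ is smooth. Put $R(x)=g(x)W^{-1}g(x)^T$. $|\cdot|$ is the Euclidean norm. Condition $(C_1)$: $f:\Omega\to\mathbb R^n$, $q:\Omega\to\mathbb R$ and $g:\Omega\to\mathbb R^{n\times m}$ are $C^\infty$; for $|x|$ small, $f(x)=Ax+O(|x|^2)$ and $q(x)=\frac12x^TQx+O(|x|^3)$, with $A\in\mathbb R^{n\times n}$ and $Q\in\mathbb R^{n\times n}$ symmetric. Condition $(C_2)$: the matrix $\begin{pmatrix}A&-R(0)\\-Q&-A^T\end{pmatrix}$ is hyperbolic (no eigenvalues on the imaginary axis), and the generalized eigenspace $E_-$ of its $n$ stable eigenvalues satisfies $E_-\oplus(\{0\}\times\mathbb R^n)=\mathbb R^{2n}$. Stabilizing solution. The Hamilton-Jacobi-Bellman equation is $$\nabla V(x)^Tf(x)-\tfrac12\nabla V(x)^TR(x)\nabla V(x)+q(x)=0.$$ A solution $V$ is called stabilizing if $\nabla V(0)=0$ and $0$ is an asymptotically stable equilibrium of the closed-loop system $\dot x=f(x)-R(x)\nabla V(x)$. The stabilizing solution $P$ of the Riccati equation $PA+A^TP-PR(0)P+Q=0$ is the symmetric solution for which all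 eigenvalues of $A-R(0)P$ have negative real part; one has $P=\frac{\partial^2V}{\partial x^2}(0)$. Standing assumption (semiglobal). $V$ is a stabilizing solution which is $C^2$ on $\Omega$ and $C^\infty$ near $0$, $p(x):=\nabla V(x)$, and the graph $\{(x,p(x)):x\in\Omega\}$ represents, over all of $\Omega$, the stable manifold at $(0,0)$ of the characteristic Hamiltonian system $$\dot x=f(x)-R(x)p,\qquad \dot p=-\Big(\tfrac{\partial f}{\partial x}\Big)^Tp+\tfrac12\Big(\tfrac{\partial(p^TR(x)p)}{\partial x}\Big)^T-\Big(\tfrac{\partial q}{\partial x}\Big)^T;$$ in particular, for every $x_0\in\Omega$ the solution of $\dot x=f(x)-R(x)p(x)$, $x(0)=x_0$, exists for all $t\ge0$, stays in $\Omega$ and converges to $0$ as $t\to+\infty$. A function $z(t)$ decays exponentially if there are $M,\alpha>0$ with $|z(t)|\le Me^{-\alpha t}$ for all $t\ge 0$. *)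

theory Defs
  imports "HOL-Analysis.Analysis" "HOL-Library.Landau_Symbols"
begin

section \<open>Smooth functions and the class of domains\<close>

text \<open>
  \<^verbatim>\<open>Ck_on k S f\<close> is meant for open \<^verbatim>\<open>S\<close>. In finite dimensions, continuity of all directional
  derivatives (with fixed direction \<^verbatim>\<open>v\<close>) is continuity of the derivative itself.
\<close>

primrec Ck_on ::
  "nat \<Rightarrow> 'a::euclidean_space set \<Rightarrow> ('a \<Rightarrow> 'b::real_normed_vector) \<Rightarrow> bool" where
  "Ck_on 0 S f = continuous_on S f"
| "Ck_on (Suc k) S f =
     ((\<forall>x\<in>S. f differentiable (at x)) \<and>
      (\<forall>v. Ck_on k S (\<lambda>x. frechet_derivative f (at x) v)))"

definition smooth_on :: "'a::euclidean_space set \<Rightarrow> ('a \<Rightarrow> 'b::real_normed_vector) \<Rightarrow> bool" where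
  "smooth_on S f \<longleftrightarrow> (\<forall>k. Ck_on k S f)"

definition grad :: "(real ^ 'n::finite \<Rightarrow> real) \<Rightarrow> real ^ 'n \<Rightarrow> real ^ 'n" where
  "grad h x = (\<chi> i. frechet_derivative h (at x) (axis i 1))"

definition smooth_hypersurface :: "(real ^ 'n::finite) set \<Rightarrow> bool" where
  "smooth_hypersurface S \<longleftrightarrow>
     (\<forall>x\<in>S. \<exists>U \<phi>. open U \<and> x \<in> U \<and> smooth_on U (\<phi> :: real ^ 'n \<Rightarrow> real) \<and>
        (\<forall>y\<in>U. grad \<phi> y \<noteq> 0) \<and> S \<inter> U = {y \<in> U. \<phi> y = 0})"

text \<open>
  The boundary is made of finitely many disjoint connected smooth hypersurfaces (the open faces)
  together with their limit points (edges, corners, conical points, ...).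
\<close>

definition piecewise_smooth_boundary :: "(real ^ 'n::finite) set \<Rightarrow> bool" where
  "piecewise_smooth_boundary \<Omega> \<longleftrightarrow>
     (\<exists>F. finite F \<and> disjoint F \<and> (\<forall>S\<in>F. connected S \<and> smooth_hypersurface S) \<and>
          frontier \<Omega> = (\<Union>S\<in>F. closure S))"

definition locally_lipschitz_on ::
  "'a::metric_space set \<Rightarrow> ('a \<Rightarrow> 'b::metric_space) \<Rightarrow> bool" where
  "locally_lipschitz_on S f \<longleftrightarrow> (\<forall>x\<in>S. \<exists>r>0. \<exists>L. L-lipschitz_on (cball x r \<inter> S) f)"

section \<open>Trajectories\<close>

definition solution_from ::
  "'a::real_normed_vector set \<Rightarrow> ('a \<Rightarrow> 'a) \<Rightarrow> 'a \<Rightarrow> (real \<Rightarrow> 'a) \<Rightarrow> bool" where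
  "solution_from D F x0 x \<longleftrightarrow>
     x 0 = x0 \<and>
     (\<forall>t\<ge>0. x t \<in> D \<and> (x has_vector_derivative F (x t)) (at t within {0..}))"

definition asymptotically_stable_at_0 ::
  "'a::real_normed_vector set \<Rightarrow> ('a \<Rightarrow> 'a) \<Rightarrow> bool" where
  "asymptotically_stable_at_0 D F \<longleftrightarrow>
     F 0 = 0 \<and>
     (\<forall>e>0. \<exists>d>0. \<forall>x0\<in>D. norm x0 < d \<longrightarrow>
        (\<exists>x. solution_from D F x0 x) \<and>
        (\<forall>x. solution_from D F x0 x \<longrightarrow> (\<forall>t\<ge>0. norm (x t) < e))) \<and>
     (\<exists>d>0. \<forall>x0\<in>D. norm x0 < d \<longrightarrow>
        (\<forall>x. solution_from D F x0 x \<longrightarrow> (x \<longlongrightarrow> 0) at_top))"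

definition decays_exponentially :: "(real \<Rightarrow> 'a::real_normed_vector) \<Rightarrow> bool" where
  "decays_exponentially z \<longleftrightarrow> (\<exists>M>0. \<exists>\<alpha>>0. \<forall>t\<ge>0. norm (z t) \<le> M * exp (- \<alpha> * t))"

section \<open>Spectral notions for real matrices\<close>

definition complex_eigenvalue :: "real ^ 'k ^ 'k::finite \<Rightarrow> complex \<Rightarrow> bool" where
  "complex_eigenvalue M \<mu> \<longleftrightarrow> (\<exists>v. v \<noteq> 0 \<and> map_matrix complex_of_real M *v v = \<mu> *s v)"

definition hyperbolic_matrix :: "real ^ 'k ^ 'k::finite \<Rightarrow> bool" where
  "hyperbolic_matrix M \<longleftrightarrow> (\<forall>\<mu>. complex_eigenvalue M \<mu> \<longrightarrow> Re \<mu> \<noteq> 0)"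

definition hurwitz_matrix :: "real ^ 'k ^ 'k::finite \<Rightarrow> bool" where
  "hurwitz_matrix M \<longleftrightarrow> (\<forall>\<mu>. complex_eigenvalue M \<mu> \<longrightarrow> Re \<mu> < 0)"

definition gen_eigenspace :: "real ^ 'k ^ 'k::finite \<Rightarrow> complex \<Rightarrow> (complex ^ 'k) set" where
  "gen_eigenspace M \<mu> =
     {v. \<exists>j. ((\<lambda>w. map_matrix complex_of_real M *v w - \<mu> *s w) ^^ j) v = 0}"

text \<open>
  The real points of the complex span of the generalized eigenspaces with \<^verbatim>\<open>Re \<mu> < 0\<close>; the stable
  spectrum is closed under conjugation, so this is the real stable generalized eigenspace.
\<close>

definition stable_eigenspace :: "real ^ 'k ^ 'k::finite \<Rightarrow> (real ^ 'k) set" where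
  "stable_eigenspace M =
     {z. (\<chi> i. complex_of_real (z $ i)) \<in> vec.span (\<Union>\<mu>\<in>{\<mu>. Re \<mu> < 0}. gen_eigenspace M \<mu>)}"

section \<open>The optimal control problem\<close>

text \<open>
  \<^verbatim>\<open>real ^ 'm ^ 'n\<close> is the type of matrices with rows indexed by \<^verbatim>\<open>'n\<close> and columns by \<^verbatim>\<open>'m\<close>.
  Functions on the domain \<open>\<Omega>\<close> are total functions whose values are used only on \<open>\<Omega>\<close>.
\<close>

definition Rmat ::
  "(real ^ 'n \<Rightarrow> real ^ 'm ^ 'n) \<Rightarrow> real ^ 'm ^ 'm \<Rightarrow> real ^ 'n::finite \<Rightarrow> real ^ 'n ^ 'n" where
  "Rmat g W x = g x ** matrix_inv W ** transpose (g x)"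

definition closed_loop ::
  "(real ^ 'n \<Rightarrow> real ^ 'n) \<Rightarrow> (real ^ 'n \<Rightarrow> real ^ 'm ^ 'n) \<Rightarrow> real ^ 'm ^ 'm \<Rightarrow>
   (real ^ 'n \<Rightarrow> real ^ 'n) \<Rightarrow> real ^ 'n::finite \<Rightarrow> real ^ 'n" where
  "closed_loop f g W p x = f x - Rmat g W x *v p x"

definition feedback ::
  "(real ^ 'n \<Rightarrow> real ^ 'm ^ 'n) \<Rightarrow> real ^ 'm ^ 'm \<Rightarrow>
   (real ^ 'n \<Rightarrow> real ^ 'n) \<Rightarrow> real ^ 'n::finite \<Rightarrow> real ^ 'm" where
  "feedback g W p x = - ((matrix_inv W ** transpose (g x)) *v p x)"

definition running_cost ::
  "(real ^ 'n \<Rightarrow> real) \<Rightarrow> real ^ 'm ^ 'm \<Rightarrow>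
   (real \<Rightarrow> real ^ 'n::finite) \<Rightarrow> (real \<Rightarrow> real ^ 'm) \<Rightarrow> real \<Rightarrow> real" where
  "running_cost q W x u t = q (x t) + 1 / 2 * (u t \<bullet> (W *v u t))"

definition cost ::
  "(real ^ 'n \<Rightarrow> real) \<Rightarrow> real ^ 'm ^ 'm \<Rightarrow>
   (real \<Rightarrow> real ^ 'n::finite) \<Rightarrow> (real \<Rightarrow> real ^ 'm) \<Rightarrow> real" where
  "cost q W x u = integral {0..} (running_cost q W x u)"

definition symmetric_matrix :: "real ^ 'k ^ 'k \<Rightarrow> bool" where
  "symmetric_matrix M \<longleftrightarrow> transpose M = M"

definition positive_definite_matrix :: "real ^ 'k ^ 'k::finite \<Rightarrow> bool" where
  "positive_definite_matrix M \<longleftrightarrow> (\<forall>u. u \<noteq> 0 \<longrightarrow> u \<bullet> (M *v u) > 0)"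

definition condition_C1 ::
  "(real ^ 'n::finite) set \<Rightarrow> (real ^ 'n \<Rightarrow> real ^ 'n) \<Rightarrow> (real ^ 'n \<Rightarrow> real ^ 'm::finite ^ 'n) \<Rightarrow>
   (real ^ 'n \<Rightarrow> real) \<Rightarrow> real ^ 'n ^ 'n \<Rightarrow> real ^ 'n ^ 'n \<Rightarrow> bool" where
  "condition_C1 \<Omega> f g q A Q \<longleftrightarrow>
     smooth_on \<Omega> f \<and> smooth_on \<Omega> g \<and> smooth_on \<Omega> q \<and> symmetric_matrix Q \<and>
     (\<lambda>x. norm (f x - A *v x)) \<in> O[nhds 0](\<lambda>x. norm x ^ 2) \<and>
     (\<lambda>x. q x - 1 / 2 * (x \<bullet> (Q *v x))) \<in> O[nhds 0](\<lambda>x. norm x ^ 3)"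

text \<open>
  \<open>\<real>\<^sup>2\<^sup>n\<close> is \<^verbatim>\<open>real ^ ('n + 'n)\<close>, with the \<^verbatim>\<open>Inl\<close> components for \<open>x\<close> and the \<^verbatim>\<open>Inr\<close> components
  for \<open>p\<close>. The argument \<^verbatim>\<open>R0\<close> stands for \<open>R(0)\<close>.
\<close>

definition hamiltonian_matrix ::
  "real ^ 'n ^ 'n \<Rightarrow> real ^ 'n ^ 'n \<Rightarrow> real ^ 'n ^ 'n \<Rightarrow> real ^ ('n + 'n) ^ ('n::finite + 'n)" where
  "hamiltonian_matrix A R0 Q = (\<chi> i j.
     (case (i, j) of
        (Inl a, Inl b) \<Rightarrow> A $ a $ b
      | (Inl a, Inr b) \<Rightarrow> - R0 $ a $ b
      | (Inr a, Inl b) \<Rightarrow> - Q $ a $ b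
      | (Inr a, Inr b) \<Rightarrow> - transpose A $ a $ b))"

definition vertical_subspace :: "(real ^ ('n::finite + 'n)) set" where
  "vertical_subspace = {z. \<forall>a. z $ Inl a = 0}"

definition condition_C2 ::
  "real ^ 'n ^ 'n \<Rightarrow> real ^ 'n ^ 'n \<Rightarrow> real ^ 'n ^ 'n::finite \<Rightarrow> bool" where
  "condition_C2 A R0 Q \<longleftrightarrow>
     (let H = hamiltonian_matrix A R0 Q in
        hyperbolic_matrix H \<and>
        stable_eigenspace H \<inter> vertical_subspace = {0} \<and>
        (\<forall>z. \<exists>a\<in>stable_eigenspace H. \<exists>b\<in>vertical_subspace. z = a + b))"

definition stabilizing_riccati_solution ::
  "real ^ 'n ^ 'n \<Rightarrow> real ^ 'n ^ 'n \<Rightarrow> real ^ 'n ^ 'n \<Rightarrow> real ^ 'n ^ 'n::finite \<Rightarrow> bool" where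
  "stabilizing_riccati_solution A R0 Q P \<longleftrightarrow>
     symmetric_matrix P \<and>
     P ** A + transpose A ** P - P ** R0 ** P + Q = 0 \<and>
     hurwitz_matrix (A - R0 ** P)"

definition stabilizing_HJB_solution ::
  "(real ^ 'n::finite) set \<Rightarrow> (real ^ 'n \<Rightarrow> real ^ 'n) \<Rightarrow> (real ^ 'n \<Rightarrow> real ^ 'm::finite ^ 'n) \<Rightarrow>
   (real ^ 'n \<Rightarrow> real) \<Rightarrow> real ^ 'm ^ 'm \<Rightarrow> (real ^ 'n \<Rightarrow> real) \<Rightarrow> (real ^ 'n \<Rightarrow> real ^ 'n) \<Rightarrow> bool" where
  "stabilizing_HJB_solution \<Omega> f g q W V p \<longleftrightarrow>
     (\<forall>x\<in>\<Omega>. GDERIV V x :> p x) \<and>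
     (\<forall>x\<in>\<Omega>. p x \<bullet> f x - 1 / 2 * (p x \<bullet> (Rmat g W x *v p x)) + q x = 0) \<and>
     p 0 = 0 \<and>
     asymptotically_stable_at_0 \<Omega> (closed_loop f g W p)"

text \<open>In the term \<open>\<partial>(p\<^sup>T R(x) p)/\<partial>x\<close> the costate \<open>p\<close> is held fixed.\<close>

definition hamiltonian_field ::
  "(real ^ 'n \<Rightarrow> real ^ 'n) \<Rightarrow> (real ^ 'n \<Rightarrow> real ^ 'm ^ 'n) \<Rightarrow> (real ^ 'n \<Rightarrow> real) \<Rightarrow>
   real ^ 'm::finite ^ 'm \<Rightarrow> (real ^ 'n) \<times> (real ^ 'n::finite) \<Rightarrow> (real ^ 'n) \<times> (real ^ 'n)" where
  "hamiltonian_field f g q W = (\<lambda>(x, p).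
     (f x - Rmat g W x *v p,
      - (transpose (jacobian f (at x)) *v p)
        + (1 / 2) *\<^sub>R grad (\<lambda>y. p \<bullet> (Rmat g W y *v p)) x - grad q x))"

definition stable_manifold ::
  "(real ^ 'n::finite) set \<Rightarrow> (real ^ 'n \<Rightarrow> real ^ 'n) \<Rightarrow> (real ^ 'n \<Rightarrow> real ^ 'm::finite ^ 'n) \<Rightarrow>
   (real ^ 'n \<Rightarrow> real) \<Rightarrow> real ^ 'm ^ 'm \<Rightarrow> ((real ^ 'n) \<times> (real ^ 'n)) set" where
  "stable_manifold \<Omega> f g q W =
     {z0. \<exists>z. solution_from (\<Omega> \<times> UNIV) (hamiltonian_field f g q W) z0 z \<and> (z \<longlongrightarrow> (0, 0)) at_top}"

definition semiglobal_solution ::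
  "(real ^ 'n::finite) set \<Rightarrow> (real ^ 'n \<Rightarrow> real ^ 'n) \<Rightarrow> (real ^ 'n \<Rightarrow> real ^ 'm::finite ^ 'n) \<Rightarrow>
   (real ^ 'n \<Rightarrow> real) \<Rightarrow> real ^ 'm ^ 'm \<Rightarrow> (real ^ 'n \<Rightarrow> real) \<Rightarrow> (real ^ 'n \<Rightarrow> real ^ 'n) \<Rightarrow> bool" where
  "semiglobal_solution \<Omega> f g q W V p \<longleftrightarrow>
     stabilizing_HJB_solution \<Omega> f g q W V p \<and>
     Ck_on 2 \<Omega> V \<and> (\<exists>r>0. smooth_on (ball 0 r) V) \<and>
     {(x, p x) | x. x \<in> \<Omega>} = stable_manifold \<Omega> f g q W \<and>
     (\<forall>x0\<in>\<Omega>. \<exists>x. solution_from \<Omega> (closed_loop f g W p) x0 x \<and> (x \<longlongrightarrow> 0) at_top)"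

end

theory Submission
  imports Defs "HOL-Computational_Algebra.Fundamental_Theorem_Algebra"
begin

text \<open>
  Since \<open>\<delta>\<close> and \<open>\<eta>\<close> are chosen after \<open>\<epsilon>\<close>, the cost difference itself can be made smaller than
  \<open>\<epsilon>\<close>, so \<^verbatim>\<open>C = 1\<close> works. Either \<open>P\<close> is the derivative of \<open>p\<close> at \<open>0\<close>, or the hypotheses (a) and (b)
  exclude each other for small \<open>\<delta>\<close>, \<open>\<eta>\<close>. In the first case \<open>A - R(0)P\<close> is Hurwitz and has a quadratic
  Lyapunov function, which yields uniform exponential decay near \<open>0\<close> for every field with nearly this
  linear part. Away from \<open>0\<close>, Gronwall's inequality keeps every trajectory starting near \<open>x\<^sub>0\<close>, of the
  exact or of the perturbed field, in a tube around the exact trajectory from \<open>x\<^sub>0\<close> until that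
  trajectory has entered the region of decay. Compactness of \<open>\<Psi>\<close> makes the tolerances uniform in \<open>x\<^sub>0\<close>.
\<close>

section \<open>Lyapunov functions of Hurwitz matrices\<close>

text \<open>Uniform closeness (a) alone only brings a trajectory near 0; an error proportional to
  \<open>norm x\<close>, as in (b), keeps 0 an equilibrium and leaves part of the linear decay rate.
  Hence \<eta> is dictated by the behaviour at 0, while \<delta> also depends on \<epsilon> and on
  the finite transit time.

  The exact and the network trajectory are not compared with each other. Both start at a point of
  \<Psi>, and each is compared, with error \<epsilon>/2, with the exact trajectory from the centre
  of a ball of a finite cover. So the perturbation estimate must allow a displaced initial point,
  and the exact feedback is one of the perturbed ones.

  A solution of the perturbed closed loop might leave \<Omega> in finite time. The shadowing
  estimate is therefore stated for fields on the whole space and asks for closeness only on a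
  compact subset \<open>K\<close> of \<Omega>. Applied to a globally Lipschitz cutoff, whose
  solutions exist for all times, it shows that the solution stays in \<open>K\<close>, where the
  cutoff changes nothing.\<close>

primrec shifted_product :: "complex ^ 'k ^ 'k::finite \<Rightarrow> complex list \<Rightarrow> complex ^ 'k \<Rightarrow> complex ^ 'k" where
  "shifted_product M [] v = v"
| "shifted_product M (\<mu> # \<mu>s) v = M *v shifted_product M \<mu>s v - \<mu> *s shifted_product M \<mu>s v"

section \<open>Products of shifts of one matrix\<close>

lemma shifted_product_add:
  "shifted_product M \<mu>s (v + w) = shifted_product M \<mu>s v + shifted_product M \<mu>s w"
  by (induction \<mu>s) (simp_all add: matrix_vector_right_distrib vector_add_ldistrib algebra_simps)

lemma shifted_product_smult: "shifted_product M \<mu>s (c *s v) = c *s shifted_product M \<mu>s v"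
  by (induction \<mu>s) (simp_all add: vector_scalar_commute vec.scale_right_diff_distrib mult.commute)

lemma scaleR_vec_complex: "r *\<^sub>R v = complex_of_real r *s (v :: complex ^ 'k)"
  by (simp add: vec_eq_iff scaleR_conv_of_real[where 'a=complex])

lemma linear_shifted_product: "linear (shifted_product M \<mu>s)"
  by (rule linearI) (simp_all add: shifted_product_add shifted_product_smult scaleR_vec_complex)

lemma shifted_product_commute: "shifted_product M \<mu>s (M *v v) = M *v shifted_product M \<mu>s v"
  by (induction \<mu>s) (simp_all add: matrix_vector_mult_diff_distrib vector_scalar_commute)

text \<open>Shifts of the same matrix commute, so the factor of any list member can be moved to the
  front. This later exhibits eigenvectors.\<close>

lemma shifted_product_remove1:
  "\<mu> \<in> set \<mu>s \<Longrightarrow> shifted_product M \<mu>s v =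
     M *v shifted_product M (remove1 \<mu> \<mu>s) v - \<mu> *s shifted_product M (remove1 \<mu> \<mu>s) v"
  by (induction \<mu>s)
     (auto simp: matrix_vector_mult_diff_distrib vector_scalar_commute vec.scale_right_diff_distrib
        mult.commute)

text \<open>Encoded through iterates of \<open>M\<close> on a vector: the product \<open>*\<close>
  on this matrix type is componentwise, so \<open>poly\<close> would not form powers of the
  matrix.\<close>

definition poly_action :: "complex poly \<Rightarrow> complex ^ 'k ^ 'k::finite \<Rightarrow> complex ^ 'k \<Rightarrow> complex ^ 'k" where
  "poly_action p M v = (\<Sum>i\<le>degree p. coeff p i *s (((*v) M) ^^ i) v)"

lemma poly_action_bound:
  assumes "degree p \<le> n"
  shows "poly_action p M v = (\<Sum>i\<le>n. coeff p i *s (((*v) M) ^^ i) v)"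
  unfolding poly_action_def using assms
  by (intro sum.mono_neutral_left) (auto simp: coeff_eq_0)

text \<open>Multiplication by \<open>[:-\<mu>, 1:]\<close> shifts the coefficients by one place and
  subtracts \<open>\<mu>\<close> times the old ones; the shifted sum is \<open>M\<close> applied to
  the old sum.\<close>

lemma poly_action_linear_factor:
  "poly_action ([:-\<mu>, 1:] * p) M v = M *v poly_action p M v - \<mu> *s poly_action p M v"
proof -
  let ?n = "degree p" and ?T = "\<lambda>i. (((*v) M) ^^ i) v"
  have coeffs: "coeff ([:-\<mu>, 1:] * p) i = (case i of 0 \<Rightarrow> 0 | Suc j \<Rightarrow> coeff p j) - \<mu> * coeff p i" for i
    by (simp add: coeff_pCons split: nat.split)
  have "degree ([:-\<mu>, 1:] * p) \<le> Suc ?n"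
    by (rule order_trans[OF degree_mult_le]) simp
  then have "poly_action ([:-\<mu>, 1:] * p) M v
      = (\<Sum>i\<le>Suc ?n. (case i of 0 \<Rightarrow> 0 | Suc j \<Rightarrow> coeff p j) *s ?T i) - (\<Sum>i\<le>Suc ?n. (\<mu> * coeff p i) *s ?T i)"
    by (simp only: poly_action_bound coeffs vec.scale_left_diff_distrib sum_subtractf)
  also have "(\<Sum>i\<le>Suc ?n. (case i of 0 \<Rightarrow> 0 | Suc j \<Rightarrow> coeff p j) *s ?T i)
      = (\<Sum>i\<le>?n. M *v (coeff p i *s ?T i))"
    by (subst sum.atMost_Suc_shift) (simp add: vector_scalar_commute)
  also have "\<dots> = M *v poly_action p M v"
    by (simp add: poly_action_def vec.linear_sum matrix_vector_mul_linear_gen)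
  also have "(\<Sum>i\<le>Suc ?n. (\<mu> * coeff p i) *s ?T i) = \<mu> *s poly_action p M v"
    by (subst poly_action_bound[of p "Suc ?n"]) (simp_all only: vec.scale_sum_right vec.scale_scale le_SucI)
  finally show ?thesis .
qed

lemma poly_action_prod:
  "poly_action (\<Prod>\<mu>\<leftarrow>\<mu>s. [:-\<mu>, 1:]) M v = shifted_product M \<mu>s v"
proof (induction \<mu>s)
  case Nil
  show ?case by (simp add: poly_action_def)
next
  case (Cons a \<mu>s)
  then show ?case using poly_action_linear_factor[of a "\<Prod>\<mu>\<leftarrow>\<mu>s. [:-\<mu>, 1:]" M v] by simp
qed

text \<open>The \<open>d + 1\<close> powers of \<open>M\<close> up to exponent \<open>d\<close> lie
  in a real vector space of dimension \<open>d\<close>, so they satisfy a linear relation.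
  Coinciding powers form a case of their own, because \<open>dependent\<close> speaks about the set
  of powers, which forgets repetitions.\<close>

lemma ex_annihilating_polynomial:
  fixes M :: "complex ^ 'k ^ 'k::finite"
  shows "\<exists>p. p \<noteq> 0 \<and> (\<forall>v. poly_action p M v = 0)"
proof -
  define N where "N = (\<lambda>i. ((\<lambda>B. M ** B) ^^ i) (mat 1))"
  have N: "N i *v v = (((*v) M) ^^ i) v" for i v
    by (induction i) (simp_all add: N_def flip: matrix_vector_mul_assoc)
  define d where "d = DIM(complex ^ 'k ^ 'k)"
  show ?thesis
  proof (cases "inj_on N {..d}")
    case False
    then obtain i j where ij: "i \<noteq> j" "N i = N j" by (auto simp: inj_on_def)
    let ?p = "monom 1 i - monom 1 j :: complex poly"
    have "coeff ?p i = 1" using ij by simp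
    then have "?p \<noteq> 0" by (metis coeff_0 zero_neq_one)
    moreover have "poly_action ?p M v = 0" for v
    proof -
      have "degree ?p \<le> max i j" by (intro degree_diff_le_max[THEN order_trans]) (simp add: degree_monom_eq)
      then have "poly_action ?p M v = (\<Sum>k\<le>max i j. (if i = k then N k *v v else 0) - (if j = k then N k *v v else 0))"
        unfolding poly_action_bound[OF \<open>degree ?p \<le> max i j\<close>] by (intro sum.cong) (auto simp: N)
      also have "\<dots> = 0" using ij by (simp add: sum_subtractf)
      finally show ?thesis .
    qed
    ultimately show ?thesis by blast
  next
    case True
    then have "card (N ` {..d}) > d" by (simp add: card_image)
    then have "dependent (N ` {..d})"
      using independent_bound[of "N ` {..d}"] by (auto simp: d_def)
    then obtain u where u: "\<exists>x\<in>N ` {..d}. u x \<noteq> 0" "(\<Sum>x\<in>N ` {..d}. u x *\<^sub>R x) = 0"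
      using dependent_finite[of "N ` {..d}"] by auto
    define p where "p = (\<Sum>i\<le>d. monom (complex_of_real (u (N i))) i)"
    have cp: "coeff p i = (if i \<le> d then complex_of_real (u (N i)) else 0)" for i
      by (simp add: p_def coeff_sum)
    have "p \<noteq> 0" using u(1) cp by (metis (no_types, lifting) atMost_iff coeff_0 imageE of_real_eq_0_iff)
    moreover have "poly_action p M v = 0" for v
    proof -
      have "degree p \<le> d" by (rule degree_le) (simp add: cp)
      then have "poly_action p M v = (\<Sum>i\<le>d. complex_of_real (u (N i)) *s (N i *v v))"
        by (simp add: poly_action_bound cp N)
      also have "\<dots> = (\<Sum>i\<le>d. (u (N i) *\<^sub>R N i) *v v)"
        by (intro sum.cong) (simp_all add: vec_eq_iff matrix_vector_mult_def sum_distrib_left scaleR_conv_of_real[where 'a=complex] mult.assoc)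
      also have "\<dots> = (\<Sum>i\<le>d. u (N i) *\<^sub>R N i) *v v"
        by (induction d) (simp_all add: matrix_vector_mult_add_rdistrib)
      also have "(\<Sum>i\<le>d. u (N i) *\<^sub>R N i) = 0" using u(2) by (simp add: sum.reindex[OF True])
      finally show ?thesis by simp
    qed
    ultimately show ?thesis by blast
  qed
qed

lemma ex_annihilating_eigenvalue_list:
  fixes M :: "complex ^ 'k ^ 'k::finite"
  shows "\<exists>\<mu>s. (\<forall>v. shifted_product M \<mu>s v = 0) \<and> (\<forall>\<mu>\<in>set \<mu>s. \<exists>v. v \<noteq> 0 \<and> M *v v = \<mu> *s v)"
proof -
  obtain p where p: "p \<noteq> 0" "\<And>v. poly_action p M v = 0" using ex_annihilating_polynomial by blast
  obtain A where A: "p = smult (lead_coeff p) (\<Prod>x\<in>#A. [:-x, 1:])"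
    using alg_closed_imp_factorization[OF p(1)] by blast
  obtain xs where xs: "A = mset xs" by (metis ex_mset)
  have "poly_action p M v = lead_coeff p *s shifted_product M xs v" for v
  proof -
    have "p = smult (lead_coeff p) (\<Prod>\<mu>\<leftarrow>xs. [:-\<mu>, 1:])"
      using A unfolding xs by (simp add: prod_mset_prod_list flip: mset_map)
    then have "poly_action p M v = poly_action (smult (lead_coeff p) (\<Prod>\<mu>\<leftarrow>xs. [:-\<mu>, 1:])) M v" by simp
    also have "\<dots> = lead_coeff p *s poly_action (\<Prod>\<mu>\<leftarrow>xs. [:-\<mu>, 1:]) M v"
      using p(1) by (simp add: poly_action_def vec.scale_sum_right)
    finally show ?thesis by (simp add: poly_action_prod)
  qed
  with p have "\<forall>v. shifted_product M xs v = 0" by simp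
  then obtain ys where ys: "\<forall>v. shifted_product M ys v = 0"
    and least: "\<And>zs. \<forall>v. shifted_product M zs v = 0 \<Longrightarrow> length ys \<le> length zs"
    using ex_has_least_nat[of "\<lambda>zs. \<forall>v. shifted_product M zs v = 0" xs length] by blast
  have "\<exists>v. v \<noteq> 0 \<and> M *v v = \<mu> *s v" if "\<mu> \<in> set ys" for \<mu>
  proof -
    have "length (remove1 \<mu> ys) < length ys" using that length_pos_if_in_set[OF that] by (simp add: length_remove1)
    then obtain v where "shifted_product M (remove1 \<mu> ys) v \<noteq> 0" using least not_less by blast
    moreover have "M *v shifted_product M (remove1 \<mu> ys) v = \<mu> *s shifted_product M (remove1 \<mu> ys) v"
      using ys shifted_product_remove1[OF that, of M v] by simp
    ultimately show ?thesis by blast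
  qed
  with ys show ?thesis by blast
qed

text \<open>Along \<open>x' = T x\<close> the derivative of \<open>B x x\<close> is
  \<open>2 * B x (T x)\<close>, so the last inequality means decay of \<open>B x x\<close> at rate
  \<open>2 * a\<close>. The lower bound by the squared norm fixes the scale; an upper bound comes
  from boundedness of \<open>B\<close>.\<close>

definition lyapunov_form :: "('a::real_normed_vector \<Rightarrow> 'a) \<Rightarrow> ('a \<Rightarrow> 'a \<Rightarrow> real) \<Rightarrow> real \<Rightarrow> bool" where
  "lyapunov_form T B a \<longleftrightarrow> bounded_bilinear B \<and> (\<forall>x y. B x y = B y x) \<and> a > 0 \<and>
     (\<forall>x. (norm x)\<^sup>2 \<le> B x x \<and> B x (T x) \<le> - a * B x x)"

text \<open>The inner product here is the real part of the Hermitian one, so the imaginary part of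
  \<mu> moves \<open>w\<close> in a direction orthogonal to \<open>w\<close>.\<close>

lemma inner_smult_complex: "w \<bullet> (\<mu> *s w) = Re \<mu> * (norm w)\<^sup>2" for w :: "complex ^ 'k"
proof -
  have "w \<bullet> (\<mu> *s w) = (\<Sum>i\<in>UNIV. Re \<mu> * (w $ i \<bullet> w $ i))"
    unfolding inner_vec_def by (intro sum.cong) (simp_all add: inner_complex_def algebra_simps)
  then show ?thesis
    by (simp add: power2_norm_eq_inner inner_vec_def sum_distrib_left)
qed

text \<open>Young's inequality with weight \<open>m\<close>, obtained by expanding the square of
  \<open>m *\<^sub>R w - v\<close>.\<close>

lemma inner_le_weighted_squares:
  fixes w v :: "'a::real_inner"
  assumes m: "m > 0"
  shows "w \<bullet> v \<le> m / 2 * (norm w)\<^sup>2 + 1 / (2 * m) * (norm v)\<^sup>2"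
proof -
  have "0 \<le> (norm (m *\<^sub>R w - v))\<^sup>2" by simp
  also have "\<dots> = m\<^sup>2 * (norm w)\<^sup>2 - 2 * m * (w \<bullet> v) + (norm v)\<^sup>2"
    unfolding power2_norm_eq_inner
    by (simp add: inner_diff inner_commute power2_eq_square algebra_simps)
  finally have "(w \<bullet> v) * (2 * m) \<le> m\<^sup>2 * (norm w)\<^sup>2 + (norm v)\<^sup>2"
    by (simp add: algebra_simps)
  then have "w \<bullet> v \<le> (m\<^sup>2 * (norm w)\<^sup>2 + (norm v)\<^sup>2) / (2 * m)"
    using m by (simp add: pos_le_divide_eq)
  also have "\<dots> = m / 2 * (norm w)\<^sup>2 + 1 / (2 * m) * (norm v)\<^sup>2"
    using m by (simp add: field_simps power2_eq_square)
  finally show ?thesis .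
qed

text \<open>
  The form is \<open>\<Sum>\<^sub>k c\<^sub>k \<langle>w\<^sub>k x, w\<^sub>k y\<rangle>\<close> with \<open>w\<^sub>k\<close> the product of the first \<open>k\<close> factors \<open>M - \<mu>\<^sub>i\<close>: along
  \<open>x' = M x\<close> one has \<open>w\<^sub>k' = \<mu>\<^sub>k\<^sub>+\<^sub>1 w\<^sub>k + w\<^sub>k\<^sub>+\<^sub>1\<close>, and each coupling term is absorbed by a large \<open>c\<^sub>k\<^sub>+\<^sub>1\<close>.
\<close>

lemma ex_lyapunov_partial:
  fixes M :: "complex ^ 'k ^ 'k::finite"
  assumes "\<forall>\<mu>\<in>set \<mu>s. Re \<mu> < 0"
  shows "\<exists>B a K. bounded_bilinear B \<and> (\<forall>x y. B x y = B y x) \<and> a > 0 \<and> K > 0 \<and>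
     (\<forall>x. (norm x)\<^sup>2 \<le> B x x \<and> B x (M *v x) \<le> - a * B x x + K * (norm (shifted_product M \<mu>s x))\<^sup>2)"
  using assms
proof (induction \<mu>s)
  case Nil
  have "linear ((*v) M)"
    by (rule linearI) (simp_all add: matrix_vector_right_distrib scaleR_vec_complex vector_scalar_commute)
  then obtain k where k: "k > 0" "\<And>x. norm (M *v x) \<le> norm x * k"
    using linear_bounded_pos[of "(*v) M"] by (metis mult.commute)
  \<comment> \<open>For the empty product the error term is a multiple of
    \<open>(norm x)\<^sup>2\<close> itself; \<open>k + 1\<close> pays for the size of
    \<open>M\<close> and for the decay rate 1.\<close>
  have "x \<bullet> (M *v x) \<le> - 1 * (x \<bullet> x) + (k + 1) * (norm x)\<^sup>2" for x
  proof -
    have "x \<bullet> (M *v x) \<le> norm x * (norm x * k)"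
      using norm_cauchy_schwarz[of x "M *v x"] k(2)[of x] mult_left_mono[of _ _ "norm x"]
      by (meson norm_ge_zero order_trans)
    then show ?thesis by (simp add: power2_norm_eq_inner[symmetric] power2_eq_square algebra_simps)
  qed
  with k(1) show ?case
    by (intro exI[of _ "(\<bullet>)"] exI[of _ 1] exI[of _ "k + 1"])
       (simp add: bounded_bilinear_inner inner_commute power2_norm_eq_inner[symmetric])
next
  case (Cons \<mu> \<mu>s)
  then obtain B a K where B: "bounded_bilinear B" "\<And>x y. B x y = B y x" "a > 0" "K > 0"
     "\<And>x. (norm x)\<^sup>2 \<le> B x x"
     "\<And>x. B x (M *v x) \<le> - a * B x x + K * (norm (shifted_product M \<mu>s x))\<^sup>2" by auto
  define m where "m = - Re \<mu>"
  have m: "m > 0" using Cons by (simp add: m_def)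
  \<comment> \<open>Young's inequality costs half of the decay \<open>m\<close> of the new square.
    As \<open>c * m = 4 * K\<close>, half of the rest absorbs the error term with factor
    \<open>K\<close> from the induction hypothesis, and the rate \<open>m / 4\<close>
    survives.\<close>
  define c where "c = 4 * K / m"
  have c: "c > 0" using m B by (simp add: c_def)
  define a' where "a' = min a (m / 4)"
  let ?w = "shifted_product M \<mu>s"
  define B' where "B' = (\<lambda>x y. B x y + c * (?w x \<bullet> ?w y))"
  have lin: "bounded_linear ?w" using linear_shifted_product linear_conv_bounded_linear by blast
  have "bilinear B'"
    unfolding bilinear_def B'_def
  proof (intro conjI allI)
    fix x
    have "linear (B x)" "linear (\<lambda>y. B y x)"
      using bounded_bilinear.bounded_linear_right[OF B(1)] bounded_bilinear.bounded_linear_left[OF B(1)]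
      by (auto simp: linear_conv_bounded_linear)
    moreover have "linear (\<lambda>y. c * (?w x \<bullet> ?w y))" "linear (\<lambda>y. c * (?w y \<bullet> ?w x))"
      by (auto intro!: linearI simp: shifted_product_add linear_scale[OF linear_shifted_product]
          inner_add algebra_simps)
    ultimately show "linear (\<lambda>y. B x y + c * (?w x \<bullet> ?w y))" "linear (\<lambda>y. B y x + c * (?w y \<bullet> ?w x))"
      by (auto intro: linear_compose_add)
  qed
  then have "bounded_bilinear B'" by (simp add: bilinear_conv_bounded_bilinear)
  moreover have "B' x y = B' y x" for x y by (simp add: B'_def B(2) inner_commute)
  moreover have "a' > 0" "c / (2 * m) > 0" using B m c by (auto simp: a'_def)
  moreover have "(norm x)\<^sup>2 \<le> B' x x" for x
    using B(5)[of x] c unfolding B'_def by (intro add_increasing2) simp_all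
  moreover have "B' x (M *v x) \<le> - a' * B' x x + c / (2 * m) * (norm (shifted_product M (\<mu> # \<mu>s) x))\<^sup>2" for x
  proof -
    let ?v = "shifted_product M (\<mu> # \<mu>s) x"
    have "?w (M *v x) = \<mu> *s ?w x + ?v" by (simp add: shifted_product_commute)
    then have "?w x \<bullet> ?w (M *v x) = - m * (norm (?w x))\<^sup>2 + ?w x \<bullet> ?v"
      by (simp only: inner_add_right inner_smult_complex m_def minus_minus)
    moreover have "?w x \<bullet> ?v \<le> m / 2 * (norm (?w x))\<^sup>2 + 1 / (2 * m) * (norm ?v)\<^sup>2"
      by (rule inner_le_weighted_squares[OF m])
    moreover define s nw nv where "s = ?w x \<bullet> ?w (M *v x)" "nw = (norm (?w x))\<^sup>2" "nv = (norm ?v)\<^sup>2"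
    ultimately have "s \<le> - (m / 2) * nw + 1 / (2 * m) * nv"
      by simp
    then have "c * s \<le> c * (- (m / 2) * nw + 1 / (2 * m) * nv)"
      by (rule mult_left_mono) (use c in simp)
    also have "\<dots> = - (c * m / 2) * nw + c / (2 * m) * nv"
      by (simp add: right_diff_distrib)
    finally have 1: "c * s \<le> - (c * m / 2) * nw + c / (2 * m) * nv" .
    have "c * m = 4 * K" using m by (simp add: c_def)
    then have 2: "- (c * m / 2) * nw + K * nw = - (m / 4) * (c * nw)"
      by (simp add: mult.commute)
    have "nw \<ge> 0" by (simp add: s_nw_nv_def)
    then have 3: "- (m / 4) * (c * nw) \<le> - a' * (c * nw)"
      using c by (intro mult_right_mono) (auto simp: a'_def)
    have "0 \<le> B x x" using B(5)[of x] by (meson order_trans zero_le_power2)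
    then have 4: "- a * B x x \<le> - a' * B x x" by (intro mult_right_mono) (auto simp: a'_def)
    have "B' x (M *v x) = B x (M *v x) + c * s" by (simp only: B'_def s_nw_nv_def)
    also have "\<dots> \<le> - a' * B x x - a' * (c * nw) + c / (2 * m) * nv"
      using B(6)[of x] 1 2 3 4 unfolding s_nw_nv_def(2)[symmetric] by linarith
    also have "\<dots> = - a' * (B x x + c * nw) + c / (2 * m) * nv"
      by (simp add: distrib_left)
    also have "\<dots> = - a' * B' x x + c / (2 * m) * (norm ?v)\<^sup>2"
      by (simp only: B'_def s_nw_nv_def power2_norm_eq_inner)
    finally show ?thesis .
  qed
  ultimately have "bounded_bilinear B' \<and> (\<forall>x y. B' x y = B' y x) \<and> a' > 0 \<and> c / (2 * m) > 0 \<and>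
     (\<forall>x. (norm x)\<^sup>2 \<le> B' x x \<and>
        B' x (M *v x) \<le> - a' * B' x x + c / (2 * m) * (norm (shifted_product M (\<mu> # \<mu>s) x))\<^sup>2)"
    by (intro conjI allI)
  then show ?case by (intro exI)
qed

text \<open>The annihilating list consists of eigenvalues, hence of numbers with negative real part,
  and the error term of the partial form vanishes because the full product is 0. The real form is
  the pullback along the isometric embedding of real into complex vectors.\<close>

lemma hurwitz_imp_lyapunov_form:
  fixes M :: "real ^ 'k ^ 'k::finite"
  assumes "hurwitz_matrix M"
  shows "\<exists>B a. lyapunov_form ((*v) M) B a"
proof -
  let ?M = "map_matrix complex_of_real M" and ?c = "\<lambda>x :: real ^ 'k. (\<chi> i. complex_of_real (x $ i))"
  obtain \<mu>s where \<mu>s: "\<forall>v. shifted_product ?M \<mu>s v = 0"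
    "\<forall>\<mu>\<in>set \<mu>s. \<exists>v. v \<noteq> 0 \<and> ?M *v v = \<mu> *s v"
    using ex_annihilating_eigenvalue_list by blast
  have "\<forall>\<mu>\<in>set \<mu>s. Re \<mu> < 0"
    using assms \<mu>s(2) by (simp add: hurwitz_matrix_def complex_eigenvalue_def)
  from ex_lyapunov_partial[OF this, of ?M] \<mu>s(1)
  obtain B a where B: "bounded_bilinear B" "\<And>x y. B x y = B y x" "a > 0"
    "\<And>x. (norm x)\<^sup>2 \<le> B x x" "\<And>x. B x (?M *v x) \<le> - a * B x x" by auto
  have "linear ?c" by (rule linearI) (simp_all add: vec_eq_iff scaleR_conv_of_real[where 'a=complex])
  then have "bounded_linear ?c" by (simp add: linear_conv_bounded_linear)
  then have "bounded_bilinear (\<lambda>x y. B (?c x) (?c y))"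
    using bounded_bilinear.comp[OF B(1)] by blast
  moreover have "(norm x)\<^sup>2 \<le> B (?c x) (?c x)" for x
    using B(4)[of "?c x"] by (simp add: norm_vec_def L2_set_def)
  moreover have "B (?c x) (?c (M *v x)) \<le> - a * B (?c x) (?c x)" for x
  proof -
    have "?M *v ?c x = ?c (M *v x)"
      by (simp add: vec_eq_iff matrix_vector_mult_def map_matrix_def)
    with B(5)[of "?c x"] show ?thesis by simp
  qed
  ultimately have "lyapunov_form ((*v) M) (\<lambda>x y. B (?c x) (?c y)) a"
    unfolding lyapunov_form_def using B(2,3) by simp
  then show ?thesis by blast
qed

section \<open>Differential inequalities and global solutions\<close>

text \<open>The integrating factor \<open>exp (- k * (t - a))\<close> makes the function
  nonincreasing. Derivatives are asked for only in the open interval, since a trajectory has a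
  one-sided derivative at time 0.\<close>

lemma exponential_comparison:
  fixes \<psi> \<psi>' :: "real \<Rightarrow> real"
  assumes "a \<le> b" and cont: "continuous_on {a..b} \<psi>"
    and deriv: "\<And>t. a < t \<Longrightarrow> t < b \<Longrightarrow> (\<psi> has_real_derivative \<psi>' t) (at t)"
    and ineq: "\<And>t. a < t \<Longrightarrow> t < b \<Longrightarrow> \<psi>' t \<le> k * \<psi> t"
  shows "\<psi> b \<le> \<psi> a * exp (k * (b - a))"
proof -
  let ?\<chi> = "\<lambda>t. \<psi> t * exp (- k * (t - a))"
  have "?\<chi> b \<le> ?\<chi> a"
  proof (rule DERIV_nonpos_imp_decreasing_open[OF \<open>a \<le> b\<close>])
    fix t assume t: "a < t" "t < b"
    have "(?\<chi> has_real_derivative (\<psi>' t - k * \<psi> t) * exp (- k * (t - a))) (at t)"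
      by (auto intro!: derivative_eq_intros deriv t simp: algebra_simps)
    moreover have "(\<psi>' t - k * \<psi> t) * exp (- k * (t - a)) \<le> 0"
      using ineq[OF t] by (simp add: mult_nonpos_nonneg)
    ultimately show "\<exists>y. (?\<chi> has_real_derivative y) (at t) \<and> y \<le> 0" by blast
  qed (intro continuous_intros cont)
  then have "\<psi> b * exp (- k * (b - a)) * exp (k * (b - a)) \<le> \<psi> a * exp (k * (b - a))"
    by (intro mult_right_mono) simp_all
  then show ?thesis by (simp add: mult.assoc flip: exp_add)
qed

text \<open>A continuity argument: the differential inequality is known only while
  \<open>\<psi> \<le> \<beta>\<close>. Up to the first time with \<open>\<psi> \<ge> \<beta>\<close>
  the comparison is valid, and its bound at that time is strictly below \<open>\<beta>\<close>, a
  contradiction.\<close>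

lemma exponential_comparison_barrier:
  fixes \<psi> \<psi>' :: "real \<Rightarrow> real"
  assumes cont: "continuous_on {a..b} \<psi>"
    and deriv: "\<And>t. a < t \<Longrightarrow> t < b \<Longrightarrow> (\<psi> has_real_derivative \<psi>' t) (at t)"
    and ineq: "\<And>t. a < t \<Longrightarrow> t < b \<Longrightarrow> \<psi> t \<le> \<beta> \<Longrightarrow> \<psi>' t \<le> k * \<psi> t"
    and below: "\<And>t. a \<le> t \<Longrightarrow> t \<le> b \<Longrightarrow> \<psi> a * exp (k * (t - a)) < \<beta>"
    and t: "t \<in> {a..b}"
  shows "\<psi> t \<le> \<psi> a * exp (k * (t - a))"
proof -
  have upto: "\<psi> s \<le> \<psi> a * exp (k * (s - a))" if s: "s \<in> {a..b}" and "\<And>u. a \<le> u \<Longrightarrow> u < s \<Longrightarrow> \<psi> u < \<beta>" for s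
    using that by (intro exponential_comparison[where \<psi>' = \<psi>'] continuous_on_subset[OF cont] deriv ineq) (auto intro: less_imp_le)
  let ?A = "{s \<in> {a..b}. \<psi> s \<ge> \<beta>}"
  have "?A = {}"
  proof (rule ccontr)
    assume "?A \<noteq> {}"
    moreover have "compact ?A"
    proof -
      have "closed ?A"
        by (intro continuous_on_closed_Collect_le cont continuous_intros closed_atLeastAtMost)
      moreover have "{a..b} \<inter> ?A = ?A" by blast
      ultimately show ?thesis using compact_Int_closed[of "{a..b}" ?A] by simp
    qed
    ultimately obtain s where s: "s \<in> ?A" "\<And>u. u \<in> ?A \<Longrightarrow> s \<le> u"
      using compact_attains_inf by meson
    have "\<psi> u < \<beta>" if "a \<le> u" "u < s" for u
      using s(2)[of u] s(1) that by (cases "\<beta> \<le> \<psi> u") auto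
    with s(1) have "\<psi> s \<le> \<psi> a * exp (k * (s - a))"
      by (intro upto) auto
    with below[of s] s(1) show False by auto
  qed
  have "\<psi> u < \<beta>" if "a \<le> u" "u \<le> b" for u
  proof (rule ccontr)
    assume "\<not> \<psi> u < \<beta>"
    with that have "u \<in> ?A" by simp
    with \<open>?A = {}\<close> show False by blast
  qed
  with t show ?thesis by (intro upto) auto
qed

section \<open>Estimates along trajectories\<close>

lemma has_vector_derivative_at_interior:
  fixes t :: real
  assumes "(z has_vector_derivative v) (at t within {s..})" and "s < t"
  shows "(z has_vector_derivative v) (at t)"
  using assms at_within_interior[of t "{s..}"] by (simp add: interior_real_atLeast)

lemma solution_from_deriv:
  assumes "solution_from D F x0 x" and "t > 0"
  shows "(x has_vector_derivative F (x t)) (at t)"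
  using assms has_vector_derivative_at_interior[of x "F (x t)" t 0] by (auto simp: solution_from_def)

lemma solution_from_continuous:
  assumes "solution_from D F x0 x"
  shows "continuous_on {0..} x"
  using assms unfolding solution_from_def
  by (auto simp: continuous_on_eq_continuous_within intro!: has_vector_derivative_continuous)

text \<open>Gronwall's inequality with the barrier \<open>r\<^sup>2\<close>, because
  \<open>F\<close> and \<open>G\<close> are controlled only inside the tube. The squared distance is
  differentiable even where the trajectories meet; adding the constant
  \<open>\<delta>\<^sup>2\<close> makes the differential inequality homogeneous, with factor
  \<open>2 * L + 1\<close>.\<close>

lemma solution_tube:
  fixes x z :: "real \<Rightarrow> 'a::real_inner"
  assumes x: "solution_from D F x0 x" and z: "solution_from E G z0 z"
    and "L \<ge> 0"
    and lip: "\<And>t y. 0 \<le> t \<Longrightarrow> t \<le> T \<Longrightarrow> norm (y - x t) \<le> r \<Longrightarrow> norm (F y - F (x t)) \<le> L * norm (y - x t)"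
    and close: "\<And>t y. 0 \<le> t \<Longrightarrow> t \<le> T \<Longrightarrow> norm (y - x t) \<le> r \<Longrightarrow> norm (G y - F y) \<le> \<delta>"
    and start: "((norm (z0 - x0))\<^sup>2 + \<delta>\<^sup>2) * exp ((2 * L + 1) * T) < r\<^sup>2" and "r > 0"
    and t: "t \<in> {0..T}"
  shows "(norm (z t - x t))\<^sup>2 \<le> ((norm (z0 - x0))\<^sup>2 + \<delta>\<^sup>2) * exp ((2 * L + 1) * T)"
proof -
  define \<psi> where "\<psi> = (\<lambda>t. (norm (z t - x t))\<^sup>2 + \<delta>\<^sup>2)"
  have \<psi>_nonneg: "\<psi> t \<ge> 0" for t by (simp add: \<psi>_def)
  have \<psi>0: "\<psi> 0 = (norm (z0 - x0))\<^sup>2 + \<delta>\<^sup>2"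
    using x z by (simp add: \<psi>_def solution_from_def)
  have grow: "\<psi> 0 * exp ((2 * L + 1) * (t - 0)) \<le> \<psi> 0 * exp ((2 * L + 1) * T)" if "t \<le> T" for t
    using that \<open>L \<ge> 0\<close> by (intro mult_left_mono \<psi>_nonneg) simp
  have "\<psi> t \<le> \<psi> 0 * exp ((2 * L + 1) * (t - 0))"
  proof (rule exponential_comparison_barrier[where \<beta> = "r\<^sup>2" and b = T, OF _ _ _ _ t])
    show "continuous_on {0..T} \<psi>" unfolding \<psi>_def
      by (intro continuous_intros continuous_on_subset[OF solution_from_continuous[OF x]]
          continuous_on_subset[OF solution_from_continuous[OF z]]) auto
  next
    fix t assume "0 < t" "t < T"
    have "((\<lambda>t. (z t - x t) \<bullet> (z t - x t)) has_vector_derivative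
        (z t - x t) \<bullet> (G (z t) - F (x t)) + (G (z t) - F (x t)) \<bullet> (z t - x t)) (at t)"
      by (intro bounded_bilinear.has_vector_derivative[OF bounded_bilinear_inner]
          has_vector_derivative_diff solution_from_deriv[OF x] solution_from_deriv[OF z] \<open>0 < t\<close>)
    then show "(\<psi> has_real_derivative 2 * ((z t - x t) \<bullet> (G (z t) - F (x t)))) (at t)"
      unfolding \<psi>_def power2_norm_eq_inner has_real_derivative_iff_has_vector_derivative
      by (auto intro!: derivative_eq_intros simp: inner_commute)
    assume "\<psi> t \<le> r\<^sup>2"
    then have "(norm (z t - x t))\<^sup>2 \<le> r\<^sup>2" unfolding \<psi>_def using zero_le_power2[of \<delta>] by linarith
    then have r: "norm (z t - x t) \<le> r" using \<open>r > 0\<close> by (auto dest: power2_le_imp_le)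
    let ?d = "norm (z t - x t)"
    have "norm (G (z t) - F (x t)) \<le> norm (G (z t) - F (z t)) + norm (F (z t) - F (x t))"
      by (rule norm_triangle_sub[of "G (z t) - F (x t)" "G (z t) - F (z t)", THEN order_trans]) simp
    also have "\<dots> \<le> \<delta> + L * ?d"
      using close[of t "z t"] lip[of t "z t"] r \<open>0 < t\<close> \<open>t < T\<close> by (intro add_mono) auto
    finally have "?d * norm (G (z t) - F (x t)) \<le> ?d * (\<delta> + L * ?d)"
      by (intro mult_left_mono) auto
    then have "2 * ((z t - x t) \<bullet> (G (z t) - F (x t))) \<le> 2 * (?d * (\<delta> + L * ?d))"
      using norm_cauchy_schwarz[of "z t - x t" "G (z t) - F (x t)"] by linarith
    also have "\<dots> = 2 * ?d * \<delta> + 2 * L * ?d\<^sup>2" by (simp add: power2_eq_square algebra_simps)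
    also have "\<dots> \<le> (?d\<^sup>2 + \<delta>\<^sup>2) + 2 * L * ?d\<^sup>2"
      using sum_squares_bound[of ?d \<delta>] by simp
    also have "\<dots> \<le> (2 * L + 1) * \<psi> t"
      using mult_nonneg_nonneg[OF \<open>L \<ge> 0\<close> zero_le_power2[of \<delta>]] by (simp add: \<psi>_def algebra_simps)
    finally show "2 * ((z t - x t) \<bullet> (G (z t) - F (x t))) \<le> (2 * L + 1) * \<psi> t" .
  next
    fix t assume "0 \<le> t" "t \<le> T"
    with grow[of t] start \<psi>0 show "\<psi> 0 * exp ((2 * L + 1) * (t - 0)) < r\<^sup>2" by simp
  qed
  with grow[of t] t \<psi>0 have "\<psi> t \<le> ((norm (z0 - x0))\<^sup>2 + \<delta>\<^sup>2) * exp ((2 * L + 1) * T)" by simp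
  then show ?thesis unfolding \<psi>_def using zero_le_power2[of \<delta>] by linarith
qed

text \<open>The linear part contributes \<open>- 2 * a * B z z\<close> to the derivative of
  \<open>B z z\<close>; by the condition on \<open>\<kappa>\<close> the remainder uses up at most
  half of this, and the rate \<open>a\<close> is left. The barrier \<open>\<rho>\<^sup>2\<close>
  keeps the trajectory in the ball where the remainder is controlled.\<close>

lemma lyapunov_decay:
  fixes z :: "real \<Rightarrow> 'a::euclidean_space"
  assumes z: "solution_from E G z0 z" and lyap: "lyapunov_form A B a"
    and b: "\<And>x y. norm (B x y) \<le> b * norm x * norm y"
    and \<kappa>: "2 * b * \<kappa> \<le> a" "b \<ge> 0"
    and near: "\<And>y. norm y \<le> \<rho> \<Longrightarrow> norm (G y - A y) \<le> \<kappa> * norm y"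
    and "s \<ge> 0" "\<rho> > 0" and start: "b * (norm (z s))\<^sup>2 < \<rho>\<^sup>2" and "s \<le> t"
  shows "(norm (z t))\<^sup>2 \<le> b * (norm (z s))\<^sup>2 * exp (- a * (t - s))"
proof -
  have bil: "bounded_bilinear B" and sym: "\<And>x y. B x y = B y x" and "a > 0"
    and lower: "\<And>x. (norm x)\<^sup>2 \<le> B x x" and dec: "\<And>x. B x (A x) \<le> - a * B x x"
    using lyap by (auto simp: lyapunov_form_def)
  define \<psi> where "\<psi> = (\<lambda>t. B (z t) (z t))"
  have \<psi>_nonneg: "\<psi> t \<ge> 0" for t unfolding \<psi>_def by (rule order_trans[OF zero_le_power2 lower])
  have upper: "\<psi> s \<le> b * (norm (z s))\<^sup>2"
    using b[of "z s" "z s"] by (simp add: \<psi>_def power2_eq_square mult.assoc)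
  have "\<psi> t \<le> \<psi> s * exp (- a * (t - s))"
  proof (rule exponential_comparison_barrier[where \<beta> = "\<rho>\<^sup>2" and b = t])
    show "continuous_on {s..t} \<psi>" unfolding \<psi>_def using \<open>s \<ge> 0\<close>
      by (intro bounded_bilinear.continuous_on[OF bil] continuous_on_subset[OF solution_from_continuous[OF z]]) auto
  next
    fix u assume u: "s < u" "u < t"
    then have "u > 0" using \<open>s \<ge> 0\<close> by simp
    have "(\<psi> has_vector_derivative B (z u) (G (z u)) + B (G (z u)) (z u)) (at u)"
      unfolding \<psi>_def
      by (intro bounded_bilinear.has_vector_derivative[OF bil] solution_from_deriv[OF z] \<open>u > 0\<close>)
    then show "(\<psi> has_real_derivative 2 * B (z u) (G (z u))) (at u)"
      by (simp add: has_real_derivative_iff_has_vector_derivative sym[of "G (z u)"])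
    assume "\<psi> u \<le> \<rho>\<^sup>2"
    then have "(norm (z u))\<^sup>2 \<le> \<rho>\<^sup>2" using lower[of "z u"] by (simp add: \<psi>_def)
    then have \<rho>: "norm (z u) \<le> \<rho>" using \<open>\<rho> > 0\<close> by (auto dest: power2_le_imp_le)
    have "B (z u) (G (z u) - A (z u)) \<le> b * norm (z u) * norm (G (z u) - A (z u))"
      using b[of "z u" "G (z u) - A (z u)"] by simp
    also have "\<dots> \<le> b * norm (z u) * (\<kappa> * norm (z u))"
      using near[OF \<rho>] \<open>b \<ge> 0\<close> by (intro mult_left_mono) auto
    finally have "2 * B (z u) (G (z u) - A (z u)) \<le> (2 * b * \<kappa>) * (norm (z u))\<^sup>2"
      by (simp add: power2_eq_square algebra_simps)
    also have "\<dots> \<le> a * (norm (z u))\<^sup>2" using \<kappa> by (intro mult_right_mono) auto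
    also have "\<dots> \<le> a * \<psi> u" using lower[of "z u"] \<open>a > 0\<close> by (simp add: \<psi>_def)
    finally have "2 * B (z u) (G (z u) - A (z u)) \<le> a * \<psi> u" .
    moreover have "B (z u) (G (z u)) = B (z u) (A (z u)) + B (z u) (G (z u) - A (z u))"
      by (simp flip: bounded_bilinear.add_right[OF bil])
    ultimately show "2 * B (z u) (G (z u)) \<le> - a * \<psi> u"
      using dec[of "z u"] by (simp add: \<psi>_def)
  next
    fix u assume "s \<le> u" "u \<le> t"
    then have "\<psi> s * exp (- a * (u - s)) \<le> \<psi> s * 1"
      using \<open>a > 0\<close> by (intro mult_left_mono \<psi>_nonneg) simp
    with upper start show "\<psi> s * exp (- a * (u - s)) < \<rho>\<^sup>2" by simp
  qed (use \<open>s \<le> t\<close> in auto)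
  also have "\<dots> \<le> b * (norm (z s))\<^sup>2 * exp (- a * (t - s))"
    using upper by (intro mult_right_mono) auto
  finally show ?thesis using lower[of "z t"] by (simp add: \<psi>_def)
qed

section \<open>Global solutions of bounded Lipschitz fields\<close>

lemma has_vector_derivative_integral_atLeast:
  fixes h :: "real \<Rightarrow> 'a::banach"
  assumes h: "continuous_on {0..} h" and "t \<ge> 0"
  shows "((\<lambda>t. integral {0..t} h) has_vector_derivative h t) (at t within {0..})"
proof -
  \<comment> \<open>The right end lies beyond \<open>t\<close>, so that near \<open>t\<close> the
    interval agrees with \<open>{0..}\<close>.\<close>
  have "((\<lambda>t. integral {0..t} h) has_vector_derivative h t) (at t within {0..t+1})"
    using \<open>t \<ge> 0\<close> by (intro integral_has_vector_derivative continuous_on_subset[OF h]) auto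
  moreover have "at t within {0..t+1} = at t within {0..}"
    by (rule at_within_nhd[of t "{..<t+1}"]) auto
  ultimately show ?thesis by simp
qed

text \<open>
  Picard iteration contracts globally in time in the norm weighted by \<open>exp (- k t)\<close>; the fixed point
  is sought as \<open>y t = exp (- k t) z t\<close>, constant for \<open>t < 0\<close>.
\<close>

lemma ex_global_solution:
  fixes G :: "'a::euclidean_space \<Rightarrow> 'a"
  assumes lip: "L-lipschitz_on UNIV G" and bd: "\<And>x. norm (G x) \<le> m"
  shows "\<exists>z. solution_from UNIV G x0 z"
proof -
  have "L \<ge> 0" using lip by (rule lipschitz_on_nonneg)
  \<comment> \<open>The contraction factor will be \<open>L / k\<close>, at most 1/2; the summand 1
    keeps \<open>k\<close> positive for \<open>L = 0\<close>.\<close>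
  define k where "k = 2 * L + 1"
  have "k > 0" using \<open>L \<ge> 0\<close> by (simp add: k_def)
  have "m \<ge> 0" using bd[of 0] by (meson norm_ge_zero order_trans)
  have G: "continuous_on S G" for S
    by (rule continuous_on_subset[OF lipschitz_on_continuous_on[OF lip]]) auto
  define h where "h = (\<lambda>(y :: real \<Rightarrow>\<^sub>C 'a) s. G (exp (k * s) *\<^sub>R y s))"
  have h: "continuous_on S (h y)" for S y
    unfolding h_def by (intro continuous_on_compose2[OF G[of UNIV]] continuous_intros) auto
  have hint: "h y integrable_on {0..t}" for y t
    by (intro integrable_continuous_interval h)
  define I where "I = (\<lambda>y t. x0 + integral {0..t} (h y))"
  have I: "(I y has_vector_derivative h y t) (at t within {0..})" if "t \<ge> 0" for y t
    unfolding I_def using has_vector_derivative_integral_atLeast[OF h that, of y]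
    by (auto intro!: derivative_eq_intros)
  have contI: "continuous_on {0..} (I y)" for y
    by (auto simp: continuous_on_eq_continuous_within intro!: has_vector_derivative_continuous I)
  define f where "f = (\<lambda>y t. exp (- k * max 0 t) *\<^sub>R I y (max 0 t))"
  \<comment> \<open>Since \<open>G\<close> is bounded, \<open>I y\<close> grows at most linearly;
    this estimate shows that the weight makes it bounded.\<close>
  have exp_le: "exp (- k * u) * u \<le> 1 / k" for u
  proof -
    have "k * u \<le> exp (k * u)" using exp_ge_add_one_self[of "k * u"] by linarith
    then show ?thesis using \<open>k > 0\<close> by (simp add: exp_minus field_simps)
  qed
  have "f y \<in> bcontfun" for y
  proof (rule bcontfun_normI[where b = "norm x0 + m / k"])
    show "continuous_on UNIV (f y)"
      unfolding f_def by (intro continuous_intros continuous_on_compose2[OF contI]) auto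
    fix t :: real
    let ?u = "max 0 t"
    have "norm (integral {0..?u} (h y)) \<le> m * (?u - 0)"
      by (rule integral_bound) (auto simp: h_def intro!: bd G h[unfolded h_def])
    then have "norm (I y ?u) \<le> norm x0 + m * ?u"
      unfolding I_def by (intro norm_triangle_le) simp
    then have "norm (f y t) \<le> exp (- k * ?u) * (norm x0 + m * ?u)"
      unfolding f_def by (simp add: mult_left_mono)
    also have "\<dots> = exp (- k * ?u) * norm x0 + m * (exp (- k * ?u) * ?u)" by (simp add: algebra_simps)
    also have "\<dots> \<le> 1 * norm x0 + m * (1 / k)"
      using \<open>k > 0\<close> by (intro add_mono mult_right_mono mult_left_mono exp_le \<open>m \<ge> 0\<close>) auto
    finally show "norm (f y t) \<le> norm x0 + m / k" by simp
  qed
  then have f: "apply_bcontfun (Bcontfun (f y)) = f y" for y by (rule Bcontfun_inverse)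
  have "\<exists>!y. Bcontfun (f y) = y"
  proof (rule banach_fix_type[of "1/2"])
    have "dist (Bcontfun (f y1)) (Bcontfun (f y2)) \<le> 1 / 2 * dist y1 y2" for y1 y2
    proof (rule dist_bound)
      fix t :: real
      let ?u = "max 0 t" and ?D = "dist y1 y2"
      have hd: "norm (h y1 s - h y2 s) \<le> L * ?D * exp (k * s)" for s
      proof -
        have "norm (h y1 s - h y2 s) \<le> L * norm (exp (k * s) *\<^sub>R y1 s - exp (k * s) *\<^sub>R y2 s)"
          unfolding h_def using lipschitz_on_normD[OF lip] by simp
        also have "\<dots> = L * (exp (k * s) * dist (y1 s) (y2 s))"
          by (simp add: dist_norm flip: scaleR_diff_right)
        also have "\<dots> \<le> L * (exp (k * s) * ?D)"
          using \<open>L \<ge> 0\<close> by (intro mult_left_mono dist_bounded) auto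
        finally show ?thesis by (simp add: mult_ac)
      qed
      have "((\<lambda>s. L * ?D * exp (k * s)) has_integral
          L * ?D / k * exp (k * ?u) - L * ?D / k * exp (k * 0)) {0..?u}"
        using \<open>k > 0\<close> by (intro fundamental_theorem_of_calculus)
          (auto intro!: derivative_eq_intros simp: field_simps simp flip: has_real_derivative_iff_has_vector_derivative)
      then have "norm (integral {0..?u} (\<lambda>s. h y1 s - h y2 s)) \<le> L * ?D / k * exp (k * ?u) - L * ?D / k"
        using hd by (intro integral_norm_bound_integral[THEN order_trans] integrable_diff hint)
          (auto simp: has_integral_iff)
      also have "\<dots> \<le> L * ?D / k * exp (k * ?u)" using \<open>L \<ge> 0\<close> \<open>k > 0\<close> by simp
      finally have "norm (I y1 ?u - I y2 ?u) \<le> L * ?D / k * exp (k * ?u)"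
        by (simp add: I_def integral_diff[OF hint hint])
      then have "norm (f y1 t - f y2 t) \<le> exp (- k * ?u) * (L * ?D / k * exp (k * ?u))"
        unfolding f_def by (simp flip: scaleR_diff_right) (simp add: mult_left_mono flip: times_divide_eq_right)
      also have "\<dots> = L / k * ?D" by (simp add: exp_minus)
      also have "\<dots> \<le> 1 / 2 * ?D" using \<open>L \<ge> 0\<close> by (intro mult_right_mono) (auto simp: k_def field_simps)
      finally show "dist (Bcontfun (f y1) t) (Bcontfun (f y2) t) \<le> 1 / 2 * ?D"
        by (simp add: f dist_norm)
    qed
    then show "\<forall>y1 y2. dist (Bcontfun (f y1)) (Bcontfun (f y2)) \<le> 1 / 2 * dist y1 y2" by blast
  qed auto
  then obtain y where "Bcontfun (f y) = y" by blast
  then have y: "y t = f y t" for t using f by metis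
  have "h y t = G (I y t)" if "t \<ge> 0" for t
    using that y[of t] by (simp add: h_def f_def exp_minus)
  with I[of _ y] have "solution_from UNIV G x0 (I y)"
    by (auto simp: solution_from_def I_def)
  then show ?thesis by blast
qed

section \<open>Locally Lipschitz functions and improper integrals\<close>

text \<open>The autonomous notion is the time-dependent one over a one-point set of times; this
  gives access to the results on continuity and on compact sets.\<close>

lemma locally_lipschitz_on_iff:
  "locally_lipschitz_on S f \<longleftrightarrow> local_lipschitz {0::real} S (\<lambda>_. f)"
proof
  assume f: "locally_lipschitz_on S f"
  show "local_lipschitz {0::real} S (\<lambda>_. f)"
    unfolding local_lipschitz_def
  proof (intro ballI)
    fix x and t :: real assume "x \<in> S"
    with f obtain r L where "r > 0" "L-lipschitz_on (cball x r \<inter> S) f"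
      unfolding locally_lipschitz_on_def by blast
    then show "\<exists>u>0. \<exists>L. \<forall>t\<in>cball t u \<inter> {0}. L-lipschitz_on (cball x u \<inter> S) f" by blast
  qed
next
  assume f: "local_lipschitz {0::real} S (\<lambda>_. f)"
  show "locally_lipschitz_on S f"
    unfolding locally_lipschitz_on_def
  proof
    fix x assume "x \<in> S"
    with f obtain r L where "r > 0" "\<forall>t\<in>cball 0 r \<inter> {0::real}. L-lipschitz_on (cball x r \<inter> S) f"
      unfolding local_lipschitz_def by blast
    then show "\<exists>r>0. \<exists>L. L-lipschitz_on (cball x r \<inter> S) f" by force
  qed
qed

lemma locally_lipschitz_on_continuous:
  assumes "locally_lipschitz_on S f"
  shows "continuous_on S f"
  using local_lipschitz_continuous_on[of "{0}" S "\<lambda>_. f" 0] assms by (simp add: locally_lipschitz_on_iff)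

lemma locally_lipschitz_on_compact:
  assumes "locally_lipschitz_on S f" "compact K" "K \<subseteq> S"
  obtains L where "L-lipschitz_on K f"
proof -
  have "local_lipschitz {0::real} K (\<lambda>_. f)"
    using assms by (auto simp: locally_lipschitz_on_iff intro: local_lipschitz_subset)
  then obtain L where "\<And>t. t \<in> {0::real} \<Longrightarrow> L-lipschitz_on K f"
    using local_lipschitz_compact_implies_lipschitz[where f = "\<lambda>_. f" and X = K and T = "{0::real}"]
      \<open>compact K\<close> by auto
  with that show ?thesis by simp
qed

text \<open>The usual splitting of a difference of products; near each point both factors are
  bounded by the value at the centre plus the Lipschitz growth over the ball.\<close>

lemma locally_lipschitz_on_bilinear:
  fixes f :: "'d::real_normed_vector \<Rightarrow> 'a::real_normed_vector" and g :: "'d \<Rightarrow> 'b::real_normed_vector"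
  assumes "bounded_bilinear pr" and f: "locally_lipschitz_on S f" and g: "locally_lipschitz_on S g"
  shows "locally_lipschitz_on S (\<lambda>x. pr (f x) (g x))"
  unfolding locally_lipschitz_on_def
proof
  fix x assume "x \<in> S"
  from f \<open>x \<in> S\<close> obtain r1 L1 where 1: "r1 > 0" "L1-lipschitz_on (cball x r1 \<inter> S) f"
    unfolding locally_lipschitz_on_def by blast
  from g \<open>x \<in> S\<close> obtain r2 L2 where 2: "r2 > 0" "L2-lipschitz_on (cball x r2 \<inter> S) g"
    unfolding locally_lipschitz_on_def by blast
  obtain k where k: "k > 0" "\<And>a b. norm (pr a b) \<le> norm a * norm b * k"
    using bounded_bilinear.pos_bounded[OF assms(1)] by blast
  define r where "r = min r1 r2"
  have "r > 0" using 1 2 by (simp add: r_def)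
  let ?B = "cball x r \<inter> S"
  have lf: "L1-lipschitz_on ?B f" and lg: "L2-lipschitz_on ?B g"
    by (rule lipschitz_on_subset[OF 1(2)] lipschitz_on_subset[OF 2(2)]; auto simp: r_def)+
  have L: "L1 \<ge> 0" "L2 \<ge> 0" using lf lg lipschitz_on_nonneg by auto
  define mf where "mf = norm (f x) + L1 * r"
  define mg where "mg = norm (g x) + L2 * r"
  have bound: "norm (f y) \<le> mf" "norm (g y) \<le> mg" if "y \<in> ?B" for y
  proof -
    have "norm (y - x) \<le> r" using that by (simp add: dist_norm norm_minus_commute)
    moreover have "norm (f y - f x) \<le> L1 * norm (y - x)" "norm (g y - g x) \<le> L2 * norm (y - x)"
      using that \<open>x \<in> S\<close> \<open>r > 0\<close> by (auto intro!: lipschitz_on_normD[OF lf] lipschitz_on_normD[OF lg])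
    ultimately have "norm (f y - f x) \<le> L1 * r" "norm (g y - g x) \<le> L2 * r"
      using L by (meson mult_left_mono order_trans)+
    then show "norm (f y) \<le> mf" "norm (g y) \<le> mg"
      using norm_triangle_sub[of "f y" "f x"] norm_triangle_sub[of "g y" "g x"] by (auto simp: mf_def mg_def)
  qed
  have m: "mf \<ge> 0" "mg \<ge> 0" using L \<open>r > 0\<close> by (auto simp: mf_def mg_def)
  have "((L1 * mg + mf * L2) * k)-lipschitz_on ?B (\<lambda>x. pr (f x) (g x))"
  proof (rule lipschitz_onI)
    fix y z assume yz: "y \<in> ?B" "z \<in> ?B"
    have "pr (f y) (g y) - pr (f z) (g z) = pr (f y - f z) (g y) + pr (f z) (g y - g z)"
      by (simp add: bounded_bilinear.diff_left[OF assms(1)] bounded_bilinear.diff_right[OF assms(1)])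
    then have "norm (pr (f y) (g y) - pr (f z) (g z))
        \<le> norm (f y - f z) * norm (g y) * k + norm (f z) * norm (g y - g z) * k"
      using norm_triangle_le[OF add_mono[OF k(2) k(2)]] by metis
    also have "\<dots> \<le> (L1 * norm (y - z)) * mg * k + mf * (L2 * norm (y - z)) * k"
      using lipschitz_on_normD[OF lf yz] lipschitz_on_normD[OF lg yz] bound yz k(1) m L
      by (intro add_mono mult_right_mono mult_mono) auto
    also have "\<dots> = (L1 * mg + mf * L2) * k * norm (y - z)" by (simp add: algebra_simps)
    finally show "dist (pr (f y) (g y)) (pr (f z) (g z)) \<le> (L1 * mg + mf * L2) * k * dist y z"
      by (simp add: dist_norm)
  qed (use k m L in auto)
  with \<open>r > 0\<close> show "\<exists>r>0. \<exists>L. L-lipschitz_on (cball x r \<inter> S) (\<lambda>x. pr (f x) (g x))" by blast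
qed

lemma locally_lipschitz_on_linear:
  assumes T: "bounded_linear T" and f: "locally_lipschitz_on S f"
  shows "locally_lipschitz_on S (\<lambda>x. T (f x))"
  unfolding locally_lipschitz_on_def
proof
  fix x assume "x \<in> S"
  from f \<open>x \<in> S\<close> obtain r L where 1: "r > 0" "L-lipschitz_on (cball x r \<inter> S) f"
    unfolding locally_lipschitz_on_def by blast
  obtain C where "C-lipschitz_on (f ` (cball x r \<inter> S)) T"
    using bounded_linear.lipschitz_boundE[OF T] by blast
  from lipschitz_on_compose2[OF 1(2) this] 1(1)
  show "\<exists>r>0. \<exists>L. L-lipschitz_on (cball x r \<inter> S) (\<lambda>x. T (f x))" by blast
qed

lemma locally_lipschitz_on_add:
  fixes f g :: "'a::metric_space \<Rightarrow> 'b::real_normed_vector"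
  assumes f: "locally_lipschitz_on S f" and g: "locally_lipschitz_on S g"
  shows "locally_lipschitz_on S (\<lambda>x. f x + g x)"
  unfolding locally_lipschitz_on_def
proof
  fix x assume "x \<in> S"
  from f \<open>x \<in> S\<close> obtain r1 L1 where 1: "r1 > 0" "L1-lipschitz_on (cball x r1 \<inter> S) f"
    unfolding locally_lipschitz_on_def by blast
  from g \<open>x \<in> S\<close> obtain r2 L2 where 2: "r2 > 0" "L2-lipschitz_on (cball x r2 \<inter> S) g"
    unfolding locally_lipschitz_on_def by blast
  have "(L1 + L2)-lipschitz_on (cball x (min r1 r2) \<inter> S) (\<lambda>x. f x + g x)"
    by (intro lipschitz_on_add lipschitz_on_subset[OF 1(2)] lipschitz_on_subset[OF 2(2)]) auto
  then show "\<exists>r>0. \<exists>L. L-lipschitz_on (cball x r \<inter> S) (\<lambda>x. f x + g x)"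
    using 1(1) 2(1) by (intro exI[of _ "min r1 r2"]) auto
qed

lemma locally_lipschitz_on_euclidean:
  fixes f :: "'a::metric_space \<Rightarrow> 'b::euclidean_space"
  assumes "\<And>i. i \<in> Basis \<Longrightarrow> locally_lipschitz_on S (\<lambda>x. f x \<bullet> i)"
  shows "locally_lipschitz_on S f"
proof -
  have "locally_lipschitz_on S (\<lambda>x. \<Sum>i\<in>A. (f x \<bullet> i) *\<^sub>R i)" if "finite A" "A \<subseteq> Basis" for A
    using that
  proof (induction A)
    case empty
    have "0-lipschitz_on (cball x 1 \<inter> S) (\<lambda>x. 0 :: 'b)" for x by (rule lipschitz_on_constant)
    then have "\<exists>r>0. \<exists>L. L-lipschitz_on (cball x r \<inter> S) (\<lambda>x. 0 :: 'b)" for x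
      using zero_less_one by blast
    then show ?case unfolding locally_lipschitz_on_def by simp
  next
    case (insert i A)
    then show ?case
      using assms by (auto intro!: locally_lipschitz_on_add
          locally_lipschitz_on_linear[OF bounded_linear_scaleR_left])
  qed
  from this[of Basis] show ?thesis by (simp add: euclidean_representation)
qed

text \<open>What is continuous by definition is the derivative in each fixed direction. Its bounds
  on a closed ball, summed over the basis, control the operator norm uniformly, and the mean value
  inequality on the convex ball applies.\<close>

lemma C1_imp_locally_lipschitz_on:
  fixes f :: "'a::euclidean_space \<Rightarrow> 'b::real_normed_vector"
  assumes "open S" and f: "Ck_on (Suc 0) S f"
  shows "locally_lipschitz_on S f"
  unfolding locally_lipschitz_on_def
proof
  fix x assume "x \<in> S"
  with \<open>open S\<close> obtain r where r: "r > 0" "cball x r \<subseteq> S" by (meson open_contains_cball)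
  let ?D = "\<lambda>y. frechet_derivative f (at y)"
  have der: "(f has_derivative ?D y) (at y)" if "y \<in> S" for y
    using f that by (simp flip: frechet_derivative_works)
  have "\<exists>m. \<forall>y\<in>cball x r. norm (?D y i) \<le> m" for i
  proof -
    have "continuous_on (cball x r) (\<lambda>y. ?D y i)" using f r by (auto intro: continuous_on_subset)
    then have "bounded ((\<lambda>y. ?D y i) ` cball x r)"
      by (intro compact_imp_bounded compact_continuous_image) auto
    then show ?thesis by (auto simp: bounded_iff)
  qed
  then obtain m where m: "\<And>i y. y \<in> cball x r \<Longrightarrow> norm (?D y i) \<le> m i" by metis
  define L where "L = (\<Sum>i\<in>Basis. \<bar>m i\<bar>)"
  have onorm: "onorm (?D y) \<le> L" if "y \<in> cball x r" for y
  proof (rule onorm_bound)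
    show "0 \<le> L" by (simp add: L_def sum_nonneg)
    have lin: "linear (?D y)" using der[of y] that r by (meson has_derivative_linear subsetD)
    fix v
    have "?D y v = ?D y (\<Sum>i\<in>Basis. (v \<bullet> i) *\<^sub>R i)" by (simp add: euclidean_representation)
    also have "\<dots> = (\<Sum>i\<in>Basis. (v \<bullet> i) *\<^sub>R ?D y i)"
      by (simp add: linear_sum[OF lin] linear_scale[OF lin])
    also have "norm \<dots> \<le> (\<Sum>i\<in>Basis. norm v * \<bar>m i\<bar>)"
    proof (rule sum_norm_le)
      fix i :: 'a assume "i \<in> Basis"
      have "norm (?D y i) \<le> \<bar>m i\<bar>" using m[OF that, of i] by linarith
      then show "norm ((v \<bullet> i) *\<^sub>R ?D y i) \<le> norm v * \<bar>m i\<bar>"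
        using Basis_le_norm[OF \<open>i \<in> Basis\<close>, of v] by (simp add: mult_mono)
    qed
    finally show "norm (?D y v) \<le> L * norm v" by (simp add: L_def sum_distrib_left mult.commute)
  qed
  have "L-lipschitz_on (cball x r) f"
  proof (rule lipschitz_onI)
    fix y z assume "y \<in> cball x r" "z \<in> cball x r"
    then have "norm (f y - f z) \<le> L * norm (y - z)"
      using r onorm by (intro differentiable_bound[of "cball x r" f ?D L])
        (auto intro!: has_derivative_at_withinI[OF der])
    then show "dist (f y) (f z) \<le> L * dist y z" by (simp add: dist_norm)
  qed (simp add: L_def sum_nonneg)
  then have "L-lipschitz_on (cball x r \<inter> S) f" by (rule lipschitz_on_subset) auto
  with r show "\<exists>r>0. \<exists>L. L-lipschitz_on (cball x r \<inter> S) f" by blast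
qed

text \<open>\<open>H\<close> is multiplied by a function of the distance to \<open>K\<close> that is
  1 on \<open>K\<close> and 0 from distance \<open>e\<close> on. The closed
  \<open>e\<close>-neighbourhood \<open>K'\<close> is a compact subset of \<Omega> and supplies a
  Lipschitz constant and a bound for \<open>H\<close>.\<close>

lemma ex_lipschitz_cutoff:
  fixes H :: "'a::euclidean_space \<Rightarrow> 'b::real_normed_vector"
  assumes "open \<Omega>" and H: "locally_lipschitz_on \<Omega> H" and K: "compact K" "K \<subseteq> \<Omega>" "K \<noteq> {}"
  shows "\<exists>G L m. L-lipschitz_on UNIV G \<and> (\<forall>x. norm (G x) \<le> m) \<and> (\<forall>x\<in>K. G x = H x)"
proof -
  obtain e where e: "e > 0" "(\<Union>x\<in>K. cball x e) \<subseteq> \<Omega>"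
    using compact_subset_open_imp_cball_epsilon_subset[OF K(1) \<open>open \<Omega>\<close> K(2)] by blast
  define K' where "K' = {y. infdist y K \<le> e}"
  have "compact K'" unfolding K'_def by (rule compact_infdist_le[OF K(3,1) e(1)])
  have "K' \<subseteq> \<Omega>"
  proof
    fix y assume "y \<in> K'"
    obtain x where "x \<in> K" "infdist y K = dist y x"
      using infdist_attains_inf[OF compact_imp_closed[OF K(1)] K(3)] by blast
    with \<open>y \<in> K'\<close> have "y \<in> cball x e" by (simp add: K'_def dist_commute)
    with e \<open>x \<in> K\<close> show "y \<in> \<Omega>" by blast
  qed
  obtain L where L: "L-lipschitz_on K' H"
    using locally_lipschitz_on_compact[OF H \<open>compact K'\<close> \<open>K' \<subseteq> \<Omega>\<close>] by blast
  then have "L \<ge> 0" by (rule lipschitz_on_nonneg)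
  have "bounded (H ` K')"
    by (intro compact_imp_bounded compact_continuous_image lipschitz_on_continuous_on[OF L] \<open>compact K'\<close>)
  then obtain m where m: "m > 0" "\<And>y. y \<in> K' \<Longrightarrow> norm (H y) \<le> m" by (auto simp: bounded_pos)
  define cut where "cut = (\<lambda>y. max 0 (1 - infdist y K / e))"
  have cut: "0 \<le> cut y" "cut y \<le> 1" for y using e(1) by (auto simp: cut_def infdist_nonneg)
  have cut_lip: "\<bar>cut y - cut z\<bar> \<le> dist y z / e" for y z
  proof -
    have "\<bar>cut y - cut z\<bar> \<le> \<bar>infdist y K / e - infdist z K / e\<bar>"
    proof -
      have "\<bar>max 0 (1 - a) - max 0 (1 - b)\<bar> \<le> \<bar>a - b\<bar>" for a b :: real by arith
      then show ?thesis unfolding cut_def .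
    qed
    also have "\<dots> = \<bar>infdist y K - infdist z K\<bar> / e"
      using e(1) by (simp only: diff_divide_distrib[symmetric] abs_divide abs_of_pos)
    also have "\<dots> \<le> dist y z / e"
      using e(1) by (intro divide_right_mono infdist_triangle_abs) auto
    finally show ?thesis .
  qed
  have cut_out: "cut y = 0" if "y \<notin> K'" for y using that e(1) by (simp add: cut_def K'_def)
  define G where "G = (\<lambda>y. if y \<in> K' then cut y *\<^sub>R H y else 0)"
  \<comment> \<open>Only \<open>y\<close> need lie in \<open>K'\<close>: for \<open>z\<close>
    outside, \<open>cut z = 0\<close> and this term is the whole difference
    \<open>G y - G z\<close>.\<close>
  have part: "norm ((cut y - cut z) *\<^sub>R H y) \<le> m / e * dist y z" if "y \<in> K'" for y z
    using mult_mono[OF cut_lip[of y z] m(2)[OF that]] e(1) m(1) by (simp add: mult.commute)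
  have "(m / e + L)-lipschitz_on UNIV G"
  proof (rule lipschitz_onI)
    fix y z :: 'a
    have extra: "m / e * dist y z \<le> (m / e + L) * dist y z"
      using \<open>L \<ge> 0\<close> by (intro mult_right_mono) auto
    consider "y \<in> K'" "z \<in> K'" | "y \<in> K'" "z \<notin> K'" | "y \<notin> K'" "z \<in> K'" | "y \<notin> K'" "z \<notin> K'" by blast
    then show "dist (G y) (G z) \<le> (m / e + L) * dist y z"
    proof cases
      case 1
      have "G y - G z = (cut y - cut z) *\<^sub>R H y + cut z *\<^sub>R (H y - H z)"
        using 1 by (simp add: G_def algebra_simps)
      also have "norm \<dots> \<le> m / e * dist y z + 1 * (L * dist y z)"
      proof (intro norm_triangle_mono part 1)
        show "norm (cut z *\<^sub>R (H y - H z)) \<le> 1 * (L * dist y z)"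
          unfolding norm_scaleR using lipschitz_on_normD[OF L 1] cut[of z] by (intro mult_mono) (auto simp: dist_norm)
      qed
      finally show ?thesis by (simp add: dist_norm algebra_simps)
    next
      case 2
      then show ?thesis using part[OF 2(1), of z] extra cut_out by (simp add: G_def)
    next
      case 3
      then show ?thesis using part[OF 3(2), of y] extra cut_out by (simp add: G_def dist_commute)
    next
      case 4
      then show ?thesis using \<open>L \<ge> 0\<close> e(1) m(1) by (simp add: G_def)
    qed
  qed (use \<open>L \<ge> 0\<close> e(1) m(1) in simp)
  moreover have "norm (G x) \<le> m" for x
  proof (cases "x \<in> K'")
    case True
    have "cut x * norm (H x) \<le> 1 * m" using cut[of x] m(2)[OF True] by (intro mult_mono) auto
    with True cut[of x] have "norm (G x) \<le> 1 * m" by (simp add: G_def)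
    then show ?thesis by simp
  qed (use m in \<open>simp add: G_def\<close>)
  moreover have "G x = H x" if "x \<in> K" for x
    using that e(1) by (simp add: G_def K'_def cut_def)
  ultimately show ?thesis by blast
qed

text \<open>\<open>N / \<alpha>\<close> is the integral of the dominating exponential over
  \<open>{T..}\<close>; before \<open>T\<close> the integrand is continuous on a compact
  interval.\<close>

lemma exponential_tail_integral:
  fixes \<phi> :: "real \<Rightarrow> real"
  assumes cont: "continuous_on {0..} \<phi>" and "T \<ge> 0" "\<alpha> > 0"
    and bound: "\<And>t. t \<ge> T \<Longrightarrow> \<bar>\<phi> t\<bar> \<le> N * exp (- \<alpha> * (t - T))"
  shows "\<phi> integrable_on {0..}" "\<bar>integral {0..} \<phi> - integral {0..T} \<phi>\<bar> \<le> N / \<alpha>"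
proof -
  let ?g = "\<lambda>t. N * exp (\<alpha> * T) * exp (- \<alpha> * t)"
  have "(?g has_integral N * exp (\<alpha> * T) * (exp (- \<alpha> * T) / \<alpha>)) {T..}"
    by (intro has_integral_mult_right has_integral_exp_minus_to_infinity \<open>\<alpha> > 0\<close>)
  moreover have "N * exp (\<alpha> * T) * (exp (- \<alpha> * T) / \<alpha>) = N / \<alpha>" by (simp add: exp_minus)
  ultimately have g: "(?g has_integral N / \<alpha>) {T..}" by (simp only:)
  have le: "norm (\<phi> t) \<le> ?g t" if "t \<in> {T..}" for t
  proof -
    have "exp (- \<alpha> * (t - T)) = exp (\<alpha> * T) * exp (- \<alpha> * t)"
      by (simp add: right_diff_distrib flip: exp_add)
    with bound[of t] that show ?thesis by (simp add: mult.assoc)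
  qed
  have tail: "\<phi> integrable_on {T..}"
  proof (rule measurable_bounded_by_integrable_imp_integrable_real)
    show "\<phi> \<in> borel_measurable (lebesgue_on {T..})"
      using \<open>T \<ge> 0\<close> by (intro continuous_imp_measurable_on_sets_lebesgue continuous_on_subset[OF cont]) auto
    show "?g integrable_on {T..}" using g by blast
  qed (use le in auto)
  have init: "\<phi> integrable_on {0..T}"
    by (intro integrable_continuous_interval continuous_on_subset[OF cont]) auto
  have un: "{0..} = {0..T} \<union> {T..}" and neg: "negligible ({0..T} \<inter> {T..})"
    using \<open>T \<ge> 0\<close> by (auto intro!: negligible_subset[of "{T}"])
  have *: "(\<phi> has_integral integral {0..T} \<phi> + integral {T..} \<phi>) {0..}"
    unfolding un by (intro has_integral_Un integrable_integral init tail neg)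
  then show "\<phi> integrable_on {0..}" by blast
  have "\<bar>integral {T..} \<phi>\<bar> \<le> N / \<alpha>"
    using integral_norm_bound_integral[OF tail, of ?g] g le by (auto simp: has_integral_iff)
  with * show "\<bar>integral {0..} \<phi> - integral {0..T} \<phi>\<bar> \<le> N / \<alpha>"
    by (simp add: has_integral_iff)
qed

text \<open>Compactness bounds the initial piece, and the factor \<open>exp (\<alpha> * T)\<close>
  moves the start of the decay from \<open>T\<close> to 0.\<close>

lemma decays_exponentially_eventually:
  assumes cont: "continuous_on {0..} z" and "T \<ge> 0" "\<alpha> > 0"
    and bound: "\<And>t. t \<ge> T \<Longrightarrow> norm (z t) \<le> N * exp (- \<alpha> * (t - T))"
  shows "decays_exponentially z"
proof -
  have "bounded (z ` {0..T})"
    by (intro compact_imp_bounded compact_continuous_image continuous_on_subset[OF cont]) auto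
  then obtain m where m: "m > 0" "\<And>t. t \<in> {0..T} \<Longrightarrow> norm (z t) \<le> m" by (auto simp: bounded_pos)
  have "N \<ge> 0" using bound[of T] norm_ge_zero[of "z T"] by (simp del: norm_ge_zero)
  have "norm (z t) \<le> (m + N) * exp (\<alpha> * T) * exp (- \<alpha> * t)" if "t \<ge> 0" for t
  proof -
    have "norm (z t) \<le> (m + N) * exp (- \<alpha> * (t - T))"
    proof (cases "t \<le> T")
      case True
      then have "exp (- \<alpha> * (t - T)) \<ge> 1" using \<open>\<alpha> > 0\<close> by (simp add: mult_nonneg_nonpos)
      then have "(m + N) * 1 \<le> (m + N) * exp (- \<alpha> * (t - T))"
        using m(1) \<open>N \<ge> 0\<close> by (intro mult_left_mono) auto
      with m(2)[of t] that True \<open>N \<ge> 0\<close> show ?thesis by simp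
    next
      case False
      then have "norm (z t) \<le> N * exp (- \<alpha> * (t - T))" using bound by simp
      also have "\<dots> \<le> (m + N) * exp (- \<alpha> * (t - T))" using m(1) by (intro mult_right_mono) auto
      finally show ?thesis .
    qed
    then show ?thesis by (simp add: right_diff_distrib mult.assoc flip: exp_add)
  qed
  then show ?thesis unfolding decays_exponentially_def using m(1) \<open>N \<ge> 0\<close> \<open>\<alpha> > 0\<close>
    by (intro exI[of _ "(m + N) * exp (\<alpha> * T)"] conjI exI[of _ \<alpha>]) auto
qed

section \<open>Shadowing a convergent trajectory\<close>

text \<open>\<open>l\<close> stands for the running cost as a function of the state.
  \<open>K\<close> and \<open>\<delta>\<close> are chosen before the field \<open>G\<close> and the
  cost \<open>h\<close>, so they serve all perturbations at once. Until a time \<open>T\<close> the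
  tube estimate controls \<open>z\<close>; afterwards Lyapunov decay controls \<open>x\<close> and
  \<open>z\<close> separately. The cost integral is split at the same \<open>T\<close>.\<close>

lemma perturbed_trajectory:
  fixes F A :: "'a::euclidean_space \<Rightarrow> 'a" and l :: "'a \<Rightarrow> real"
  assumes "open \<Omega>" and F: "locally_lipschitz_on \<Omega> F" and l: "locally_lipschitz_on \<Omega> l"
    and lyap: "lyapunov_form A B a" and b: "\<And>x y. norm (B x y) \<le> b * norm x * norm y" "b > 0"
    and \<kappa>: "2 * b * \<kappa> \<le> a" and \<rho>: "\<rho> > 0" "cball 0 \<rho> \<subseteq> \<Omega>" and "c \<ge> 0"
    and nearF: "\<And>y. norm y \<le> \<rho> \<Longrightarrow> norm (F y - A y) \<le> \<kappa> * norm y"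
    and nearl: "\<And>y. norm y \<le> \<rho> \<Longrightarrow> \<bar>l y\<bar> \<le> c * norm y"
    and x: "solution_from \<Omega> F x0 x" "(x \<longlongrightarrow> 0) at_top" and "\<epsilon> > 0"
  obtains K \<delta> where "compact K" "K \<subseteq> \<Omega>" "cball 0 \<rho> \<subseteq> K" "\<delta> > 0"
    "\<And>G h y0 z. \<lbrakk>norm (y0 - x0) \<le> \<delta>; \<And>y. y \<in> K \<Longrightarrow> norm (G y - F y) \<le> \<delta>;
        \<And>y. y \<in> K \<Longrightarrow> \<bar>h y - l y\<bar> \<le> \<delta>; continuous_on K h;
        \<And>y. norm y \<le> \<rho> \<Longrightarrow> norm (G y - A y) \<le> \<kappa> * norm y;
        \<And>y. norm y \<le> \<rho> \<Longrightarrow> \<bar>h y\<bar> \<le> c * norm y;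
        solution_from UNIV G y0 z\<rbrakk> \<Longrightarrow>
      (\<forall>t\<ge>0. z t \<in> K \<and> norm (z t - x t) < \<epsilon>) \<and> decays_exponentially z \<and>
      (\<lambda>t. h (z t)) integrable_on {0..} \<and>
      \<bar>integral {0..} (\<lambda>t. h (z t)) - integral {0..} (\<lambda>t. l (x t))\<bar> < \<epsilon>"
proof -
  have "a > 0" using lyap by (simp add: lyapunov_form_def)
  \<comment> \<open>A positive replacement for \<open>c\<close> in denominators, since
    \<open>c\<close> may be 0.\<close>
  define d where "d = c + 1"
  have d: "d > 0" "c \<le> d" using \<open>c \<ge> 0\<close> by (auto simp: d_def)
  \<comment> \<open>\<open>N\<close> will bound both trajectories after time \<open>T\<close>. The
    three entries keep them inside the ball of radius \<open>\<rho>\<close>, keep their distance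
    below \<open>\<epsilon>\<close>, and make each cost tail at most
    \<open>\<epsilon> / 8\<close>.\<close>
  define N where "N = min (\<rho> / 2) (min (\<epsilon> / 4) (a * \<epsilon> / (16 * d)))"
  have "a * \<epsilon> / (16 * d) > 0" using \<open>\<epsilon> > 0\<close> \<open>a > 0\<close> d by simp
  then have "N > 0" "N \<le> \<rho> / 2" "N \<le> \<epsilon> / 4"
    using \<rho>(1) \<open>\<epsilon> > 0\<close> unfolding N_def by linarith+
  then have N: "N > 0" "N < \<rho>" "2 * N < \<epsilon>" using \<rho>(1) \<open>\<epsilon> > 0\<close> by linarith+
  have cN: "c * N / (a / 2) \<le> \<epsilon> / 8"
  proof -
    have "c * N \<le> d * (a * \<epsilon> / (16 * d))"
      using N(1) d by (intro mult_mono) (auto simp: N_def)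
    also have "\<dots> = a * \<epsilon> / 16" using d by simp
    finally show ?thesis using \<open>a > 0\<close> by (simp add: field_simps)
  qed
  \<comment> \<open>Chosen with \<open>b * \<sigma>\<^sup>2 = N\<^sup>2\<close>: from a point of
    norm at most \<open>\<sigma>\<close> a trajectory decays with prefactor
    \<open>N\<close>.\<close>
  define \<sigma> where "\<sigma> = N / sqrt b"
  have "\<sigma> > 0" using N b by (simp add: \<sigma>_def)
  have decay: "norm (w t) \<le> N * exp (- (a / 2) * (t - s))"
    if w: "solution_from E G w0 w" and near: "\<And>y. norm y \<le> \<rho> \<Longrightarrow> norm (G y - A y) \<le> \<kappa> * norm y"
      and s: "s \<ge> 0" "norm (w s) \<le> \<sigma>" "s \<le> t" for E G w0 w s t
  proof -
    have start: "b * (norm (w s))\<^sup>2 \<le> N\<^sup>2"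
    proof -
      have "b * (norm (w s))\<^sup>2 \<le> b * \<sigma>\<^sup>2"
        using s b by (intro mult_left_mono power_mono) auto
      also have "\<dots> = N\<^sup>2" using b by (simp add: \<sigma>_def power_divide)
      finally show ?thesis .
    qed
    also have "N\<^sup>2 < \<rho>\<^sup>2" using N by (intro power_strict_mono) auto
    finally have "(norm (w t))\<^sup>2 \<le> b * (norm (w s))\<^sup>2 * exp (- a * (t - s))"
      using b \<kappa> s \<rho>(1) by (intro lyapunov_decay[OF w lyap b(1) \<kappa> _ near]) auto
    also have "\<dots> \<le> N\<^sup>2 * exp (- a * (t - s))"
      using start by (intro mult_right_mono) auto
    also have "\<dots> = (N * exp (- (a / 2) * (t - s)))\<^sup>2"
    proof -
      have "- a * (t - s) = 2 * (- (a / 2) * (t - s))" by simp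
      then show ?thesis by (simp only: power_mult_distrib exp_double)
    qed
    finally show ?thesis by (rule power2_le_imp_le) (use N(1) in simp)
  qed
  have "\<forall>\<^sub>F t in at_top. dist (x t) 0 < \<sigma> / 2"
    using x(2) \<open>\<sigma> > 0\<close> by (intro tendstoD) auto
  then obtain T0 where T0: "\<And>t. t \<ge> T0 \<Longrightarrow> norm (x t) < \<sigma> / 2"
    by (auto simp: eventually_at_top_linorder)
  define T where "T = max T0 0"
  have T: "T \<ge> 0" "norm (x T) \<le> \<sigma> / 2" using T0[of T] by (auto simp: T_def)
  \<comment> \<open>\<open>T\<close> may be 0, and \<open>T1\<close> is the time length to divide
    by.\<close>
  define T1 where "T1 = T + 1"
  have T1: "T1 > 0" "T \<le> T1" using T by (auto simp: T1_def)
  let ?X = "x ` {0..T}"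
  have "compact ?X"
    by (intro compact_continuous_image continuous_on_subset[OF solution_from_continuous[OF x(1)]]) auto
  moreover have "?X \<subseteq> \<Omega>" using x(1) by (auto simp: solution_from_def)
  ultimately obtain r0 where r0: "r0 > 0" "(\<Union>y\<in>?X. cball y r0) \<subseteq> \<Omega>"
    using compact_subset_open_imp_cball_epsilon_subset[OF _ \<open>open \<Omega>\<close>] by blast
  define K where "K = (\<Union>y\<in>?X. cball y r0) \<union> cball 0 \<rho>"
  have "(\<Union>y\<in>?X. cball y r0) = {y + v | y v. y \<in> ?X \<and> v \<in> cball 0 r0}"
  proof (intro equalityI subsetI)
    fix u assume "u \<in> (\<Union>y\<in>?X. cball y r0)"
    then obtain y where "y \<in> ?X" "u \<in> cball y r0" by blast
    then have "u = y + (u - y)" "y \<in> ?X" "u - y \<in> cball 0 r0" by (auto simp: dist_norm norm_minus_commute)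
    then show "u \<in> {y + v | y v. y \<in> ?X \<and> v \<in> cball 0 r0}" by blast
  next
    fix u assume "u \<in> {y + v | y v. y \<in> ?X \<and> v \<in> cball 0 r0}"
    then obtain y v where "y \<in> ?X" "u = y + v" "norm v \<le> r0" by auto
    then have "u \<in> cball y r0" by (simp add: dist_norm)
    with \<open>y \<in> ?X\<close> show "u \<in> (\<Union>y\<in>?X. cball y r0)" by blast
  qed
  then have "compact K"
    unfolding K_def using compact_sums[OF \<open>compact ?X\<close> compact_cball[of 0 r0]] by (intro compact_Un) auto
  have "K \<subseteq> \<Omega>" unfolding K_def using r0(2) \<rho>(2) by blast
  obtain L where L: "L-lipschitz_on K F" by (rule locally_lipschitz_on_compact[OF F \<open>compact K\<close> \<open>K \<subseteq> \<Omega>\<close>])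
  obtain L' where L': "L'-lipschitz_on K l" by (rule locally_lipschitz_on_compact[OF l \<open>compact K\<close> \<open>K \<subseteq> \<Omega>\<close>])
  have nn: "L \<ge> 0" "L' \<ge> 0" using L L' lipschitz_on_nonneg by auto
  define L1 where "L1 = L' + 1"
  have L1: "L1 > 0" "L' \<le> L1" using nn by (auto simp: L1_def)
  \<comment> \<open>In this order: the tube lies in \<open>K\<close>; \<open>z T\<close> has norm at
    most \<open>\<sigma>\<close>, because \<open>x T\<close> has norm at most
    \<open>\<sigma> / 2\<close>; the distance stays below \<open>\<epsilon>\<close>;
    \<open>l\<close> varies by at most \<open>\<epsilon> / (8 * T1)\<close> across the tube.\<close>
  define r where "r = Min {r0, \<sigma> / 2, \<epsilon> / 2, \<epsilon> / (8 * L1 * T1)}"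
  have r: "r > 0" "r \<le> r0" "r \<le> \<sigma> / 2" "r \<le> \<epsilon> / 2" "r \<le> \<epsilon> / (8 * L1 * T1)"
    using r0 \<open>\<sigma> > 0\<close> \<open>\<epsilon> > 0\<close> L1 T1 by (auto simp: r_def)
  define E where "E = exp ((2 * L + 1) * T)"
  have "E \<ge> 1" using nn T by (simp add: E_def)
  \<comment> \<open>With the first entry the Gronwall bound \<open>2 * \<delta>\<^sup>2 * E\<close>
    is at most \<open>r\<^sup>2 / (2 * E)\<close>, below \<open>r\<^sup>2\<close> as
    \<open>E \<ge> 1\<close>. The second limits the error \<open>h - l\<close> over the
    transit.\<close>
  define \<delta> where "\<delta> = min (r / (2 * E)) (\<epsilon> / (8 * T1))"
  have \<delta>: "\<delta> > 0" "\<delta> \<le> r / (2 * E)" "\<delta> \<le> \<epsilon> / (8 * T1)"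
    using r \<open>E \<ge> 1\<close> \<open>\<epsilon> > 0\<close> T1 by (auto simp: \<delta>_def)
  have \<delta>E: "(\<delta>\<^sup>2 + \<delta>\<^sup>2) * E < r\<^sup>2"
  proof -
    have "\<delta>\<^sup>2 \<le> (r / (2 * E))\<^sup>2" using \<delta> by (intro power_mono) auto
    then have "(\<delta>\<^sup>2 + \<delta>\<^sup>2) * E \<le> ((r / (2 * E))\<^sup>2 + (r / (2 * E))\<^sup>2) * E"
      using \<open>E \<ge> 1\<close> by (intro mult_right_mono) auto
    also have "\<dots> = r\<^sup>2 * (1 / (2 * E))"
      using \<open>E \<ge> 1\<close> by (simp add: power2_eq_square field_simps)
    also have "\<dots> < r\<^sup>2 * 1"
      using \<open>E \<ge> 1\<close> r(1) by (intro mult_strict_left_mono) auto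
    finally show ?thesis by simp
  qed
  have tube_K: "y \<in> K" if "0 \<le> t" "t \<le> T" "norm (y - x t) \<le> r" for t y
  proof -
    have "y \<in> cball (x t) r0" using that r by (simp add: dist_norm norm_minus_commute)
    with that show ?thesis by (auto simp: K_def)
  qed
  have x_decay: "norm (x t) \<le> N * exp (- (a / 2) * (t - T))" if "T \<le> t" for t
    using T \<open>\<sigma> > 0\<close> that by (intro decay[OF x(1) nearF]) auto
  have exp_small: "N * exp (- (a / 2) * (t - T)) \<le> N" if "T \<le> t" for t
  proof -
    have "exp (- (a / 2) * (t - T)) \<le> 1" using that \<open>a > 0\<close> by simp
    then show ?thesis using N(1) by simp
  qed
  have lx: "continuous_on {0..} (\<lambda>t. l (x t))"
    by (rule continuous_on_compose2[OF locally_lipschitz_on_continuous[OF l] solution_from_continuous[OF x(1)]])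
      (use x(1) in \<open>auto simp: solution_from_def\<close>)
  have tail_bound: "\<bar>k (w t)\<bar> \<le> (c * N) * exp (- (a / 2) * (t - T))"
    if "\<And>y. norm y \<le> \<rho> \<Longrightarrow> \<bar>k y\<bar> \<le> c * norm y"
      "norm (w t) \<le> N * exp (- (a / 2) * (t - T))" "T \<le> t" for k :: "'a \<Rightarrow> real" and w t
  proof -
    have "norm (w t) \<le> \<rho>" using that(2) exp_small[OF that(3)] N(2) by linarith
    then have "\<bar>k (w t)\<bar> \<le> c * norm (w t)" by (rule that(1))
    also have "\<dots> \<le> c * (N * exp (- (a / 2) * (t - T)))" using that \<open>c \<ge> 0\<close> by (intro mult_left_mono)
    finally show ?thesis by (simp add: mult.assoc)
  qed
  have cost_x: "\<bar>integral {0..} (\<lambda>t. l (x t)) - integral {0..T} (\<lambda>t. l (x t))\<bar> \<le> c * N / (a / 2)"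
    using T \<open>a > 0\<close> by (intro exponential_tail_integral lx tail_bound nearl x_decay) auto
  show ?thesis
  proof (rule that)
    fix G h y0 z
    assume y0: "norm (y0 - x0) \<le> \<delta>" and GF: "\<And>y. y \<in> K \<Longrightarrow> norm (G y - F y) \<le> \<delta>"
      and hl: "\<And>y. y \<in> K \<Longrightarrow> \<bar>h y - l y\<bar> \<le> \<delta>" and h: "continuous_on K h"
      and nearG: "\<And>y. norm y \<le> \<rho> \<Longrightarrow> norm (G y - A y) \<le> \<kappa> * norm y"
      and nearh: "\<And>y. norm y \<le> \<rho> \<Longrightarrow> \<bar>h y\<bar> \<le> c * norm y"
      and z: "solution_from UNIV G y0 z"
    have start: "((norm (y0 - x0))\<^sup>2 + \<delta>\<^sup>2) * E < r\<^sup>2"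
    proof -
      have "((norm (y0 - x0))\<^sup>2 + \<delta>\<^sup>2) * E \<le> (\<delta>\<^sup>2 + \<delta>\<^sup>2) * E"
        using \<open>E \<ge> 1\<close> y0 by (intro mult_right_mono add_right_mono power_mono) auto
      with \<delta>E show ?thesis by simp
    qed
    have close: "norm (z t - x t) \<le> r" if t: "0 \<le> t" "t \<le> T" for t
    proof -
      have "(norm (z t - x t))\<^sup>2 \<le> ((norm (y0 - x0))\<^sup>2 + \<delta>\<^sup>2) * E"
        unfolding E_def
      proof (rule solution_tube[OF x(1) z nn(1)])
        fix s y assume s: "0 \<le> s" "s \<le> T" "norm (y - x s) \<le> r"
        then show "norm (G y - F y) \<le> \<delta>" by (intro GF tube_K)
        show "norm (F y - F (x s)) \<le> L * norm (y - x s)"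
          using s r by (intro lipschitz_on_normD[OF L] tube_K[of s]) auto
      qed (use start t r in \<open>auto simp: E_def\<close>)
      with start have "(norm (z t - x t))\<^sup>2 \<le> r\<^sup>2" by simp
      then show ?thesis by (rule power2_le_imp_le) (use r(1) in simp)
    qed
    have zT: "norm (z T) \<le> \<sigma>"
      using close[of T] T r(3) norm_triangle_sub[of "z T" "x T"] by simp
    have z_decay: "norm (z t) \<le> N * exp (- (a / 2) * (t - T))" if "T \<le> t" for t
      using T zT that by (intro decay[OF z nearG]) auto
    have K: "z t \<in> K \<and> norm (z t - x t) < \<epsilon>" if "t \<ge> 0" for t
    proof (cases "t \<le> T")
      case True
      then show ?thesis using close[of t] that tube_K[of t "z t"] r(4) \<open>\<epsilon> > 0\<close> by auto
    next
      case False
      then have "norm (z t) \<le> N" "norm (x t) \<le> N"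
        using z_decay[of t] x_decay[of t] exp_small[of t] by auto
      then show ?thesis using N norm_triangle_ineq4[of "z t" "x t"] by (auto simp: K_def)
    qed
    have hz: "continuous_on {0..} (\<lambda>t. h (z t))"
      by (rule continuous_on_compose2[OF h solution_from_continuous[OF z]]) (use K in auto)
    have "\<bar>h (z t)\<bar> \<le> (c * N) * exp (- (a / 2) * (t - T))" if "T \<le> t" for t
      using nearh z_decay[OF that] that by (rule tail_bound)
    then have hz_int: "(\<lambda>t. h (z t)) integrable_on {0..}"
      and cost_z: "\<bar>integral {0..} (\<lambda>t. h (z t)) - integral {0..T} (\<lambda>t. h (z t))\<bar> \<le> c * N / (a / 2)"
      using exponential_tail_integral[OF hz T(1), of "a / 2" "c * N"] \<open>a > 0\<close> by auto
    have "\<bar>integral {0..T} (\<lambda>t. h (z t)) - integral {0..T} (\<lambda>t. l (x t))\<bar> \<le> \<epsilon> / 4"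
    proof -
      have int: "(\<lambda>t. h (z t)) integrable_on {0..T}" "(\<lambda>t. l (x t)) integrable_on {0..T}"
        by (intro integrable_continuous_interval continuous_on_subset[OF hz] continuous_on_subset[OF lx]; force)+
      have "\<bar>h (z t) - l (x t)\<bar> \<le> \<epsilon> / (4 * T1)" if t: "t \<in> {0..T}" for t
      proof -
        have "\<bar>h (z t) - l (z t)\<bar> \<le> \<epsilon> / (8 * T1)" using K[of t] t hl[of "z t"] \<delta>(3) by force
        moreover have "\<bar>l (z t) - l (x t)\<bar> \<le> \<epsilon> / (8 * T1)"
        proof -
          have "x t \<in> K" using t tube_K[of t "x t"] r(1) by simp
          then have "\<bar>l (z t) - l (x t)\<bar> \<le> L' * norm (z t - x t)"
            using K[of t] t lipschitz_on_normD[OF L', of "z t" "x t"] by simp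
          also have "\<dots> \<le> L1 * (\<epsilon> / (8 * L1 * T1))"
            using close[of t] t L1 r(5) by (intro mult_mono) auto
          also have "\<dots> = \<epsilon> / (8 * T1)" using L1 by simp
          finally show ?thesis .
        qed
        ultimately have "\<bar>h (z t) - l (x t)\<bar> \<le> \<epsilon> / (8 * T1) + \<epsilon> / (8 * T1)" by linarith
        also have "\<dots> = \<epsilon> / (4 * T1)" using T1 by (simp add: field_simps)
        finally show ?thesis .
      qed
      then have "norm (integral {0..T} (\<lambda>t. h (z t) - l (x t))) \<le> integral {0..T} (\<lambda>_. \<epsilon> / (4 * T1))"
        by (intro integral_norm_bound_integral integrable_diff int) auto
      also have "\<dots> = T * (\<epsilon> / (4 * T1))" using T by simp
      also have "\<dots> \<le> T1 * (\<epsilon> / (4 * T1))" using T1 \<open>\<epsilon> > 0\<close> by (intro mult_right_mono) auto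
      also have "\<dots> = \<epsilon> / 4" using T1 by simp
      finally show ?thesis by (simp add: integral_diff[OF int])
    qed
    \<comment> \<open>Each tail contributes at most \<open>\<epsilon> / 8\<close> and the transit at
      most \<open>\<epsilon> / 4\<close>, in total \<open>\<epsilon> / 2\<close>.\<close>
    with cost_x cost_z cN
    have "\<bar>integral {0..} (\<lambda>t. h (z t)) - integral {0..} (\<lambda>t. l (x t))\<bar> < \<epsilon>"
      using \<open>\<epsilon> > 0\<close> by linarith
    moreover have "decays_exponentially z"
      using decays_exponentially_eventually[OF solution_from_continuous[OF z] T(1), of "a / 2" N] z_decay \<open>a > 0\<close>
      by auto
    ultimately show "(\<forall>t\<ge>0. z t \<in> K \<and> norm (z t - x t) < \<epsilon>) \<and> decays_exponentially z \<and>
      (\<lambda>t. h (z t)) integrable_on {0..} \<and>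
      \<bar>integral {0..} (\<lambda>t. h (z t)) - integral {0..} (\<lambda>t. l (x t))\<bar> < \<epsilon>"
      using K hz_int by blast
  qed (use \<open>compact K\<close> \<open>K \<subseteq> \<Omega>\<close> \<delta> in \<open>auto simp: K_def\<close>)
qed

section \<open>The closed loop\<close>

lemma bounded_bilinear_matrix_vector_mult:
  "bounded_bilinear ((*v) :: real ^ 'n ^ 'm \<Rightarrow> real ^ 'n \<Rightarrow> real ^ 'm)"
  unfolding bilinear_conv_bounded_bilinear[symmetric] bilinear_def
  by (auto intro!: linearI simp: matrix_vector_right_distrib matrix_vector_mult_scaleR
      matrix_vector_mult_add_rdistrib scaleR_matrix_vector_assoc)

lemma bounded_bilinear_matrix_matrix_mult:
  "bounded_bilinear ((**) :: real ^ 'n ^ 'm \<Rightarrow> real ^ 'k ^ 'n \<Rightarrow> real ^ 'k ^ 'm)"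
  unfolding bilinear_conv_bounded_bilinear[symmetric] bilinear_def
  by (auto intro!: linearI simp: matrix_matrix_mult_def vec_eq_iff sum.distrib sum_distrib_left algebra_simps)

lemma bounded_linear_transpose: "bounded_linear (transpose :: real ^ 'n ^ 'm \<Rightarrow> real ^ 'm ^ 'n)"
  unfolding linear_conv_bounded_linear[symmetric]
  by (intro linearI) (auto simp: transpose_def vec_eq_iff)

text \<open>Under feedback the integrand of \<open>J\<close> is a function of the state alone, which
  is the form that the shadowing estimate handles.\<close>

definition loop_cost ::
  "(real ^ 'n \<Rightarrow> real) \<Rightarrow> (real ^ 'n \<Rightarrow> real ^ 'm ^ 'n) \<Rightarrow> real ^ 'm ^ 'm \<Rightarrow>
   (real ^ 'n \<Rightarrow> real ^ 'n) \<Rightarrow> real ^ 'n::finite \<Rightarrow> real" where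
  "loop_cost q g W p x = q x + 1 / 2 * (feedback g W p x \<bullet> (W *v feedback g W p x))"

lemma running_cost_feedback:
  "running_cost q W x (\<lambda>t. feedback g W p (x t)) = (\<lambda>t. loop_cost q g W p (x t))"
  by (simp add: running_cost_def loop_cost_def fun_eq_iff)

lemma bounded_bilinear_weight: "bounded_bilinear (\<lambda>u v. u \<bullet> (W *v v))" for W :: "real ^ 'm ^ 'm"
  using bounded_bilinear.comp[OF bounded_bilinear_inner bounded_linear_ident
      bounded_bilinear.bounded_linear_right[OF bounded_bilinear_matrix_vector_mult, of W]] .

context
  fixes \<Omega> :: "(real ^ 'n::finite) set" and g :: "real ^ 'n \<Rightarrow> real ^ 'm::finite ^ 'n" and W :: "real ^ 'm ^ 'm"
  assumes g: "locally_lipschitz_on \<Omega> g"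
begin

lemma gain_locally_lipschitz: "locally_lipschitz_on \<Omega> (\<lambda>x. matrix_inv W ** transpose (g x))"
  by (intro locally_lipschitz_on_linear[OF
        bounded_bilinear.bounded_linear_right[OF bounded_bilinear_matrix_matrix_mult]]
      locally_lipschitz_on_linear[OF bounded_linear_transpose] g)

lemma Rmat_locally_lipschitz: "locally_lipschitz_on \<Omega> (Rmat g W)"
  using locally_lipschitz_on_bilinear[OF bounded_bilinear_matrix_matrix_mult g gain_locally_lipschitz]
  unfolding Rmat_def matrix_mul_assoc .

lemma closed_loop_locally_lipschitz:
  assumes "locally_lipschitz_on \<Omega> f" "locally_lipschitz_on \<Omega> p"
  shows "locally_lipschitz_on \<Omega> (closed_loop f g W p)"
  using locally_lipschitz_on_add[OF assms(1) locally_lipschitz_on_linear[OF bounded_linear_minus[OF bounded_linear_ident]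
      locally_lipschitz_on_bilinear[OF bounded_bilinear_matrix_vector_mult Rmat_locally_lipschitz assms(2)]]]
  by (simp add: closed_loop_def[abs_def])

lemma feedback_locally_lipschitz:
  assumes "locally_lipschitz_on \<Omega> p"
  shows "locally_lipschitz_on \<Omega> (feedback g W p)"
  unfolding feedback_def
  by (intro locally_lipschitz_on_linear[OF bounded_linear_minus[OF bounded_linear_ident]]
      locally_lipschitz_on_bilinear[OF bounded_bilinear_matrix_vector_mult gain_locally_lipschitz] assms)

lemma loop_cost_locally_lipschitz:
  assumes "locally_lipschitz_on \<Omega> q" "locally_lipschitz_on \<Omega> p"
  shows "locally_lipschitz_on \<Omega> (loop_cost q g W p)"
  unfolding loop_cost_def
  by (intro locally_lipschitz_on_add assms(1) locally_lipschitz_on_linear[OF bounded_linear_mult_right]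
      locally_lipschitz_on_bilinear[OF bounded_bilinear_weight] feedback_locally_lipschitz assms(2))

text \<open>The field is affine and the cost quadratic in the costate, with coefficients bounded on
  the compact set \<open>K\<close>; hence one \<open>\<delta>\<close> serves every
  \<open>p'\<close>.\<close>

lemma costate_perturbation:
  assumes K: "compact K" "K \<subseteq> \<Omega>" and p: "locally_lipschitz_on \<Omega> p" and "\<epsilon> > 0"
  shows "\<exists>\<delta>>0. \<forall>p'. (\<forall>y\<in>K. norm (p' y - p y) \<le> \<delta>) \<longrightarrow>
    (\<forall>y\<in>K. norm (closed_loop f g W p' y - closed_loop f g W p y) \<le> \<epsilon> \<and>
           \<bar>loop_cost q g W p' y - loop_cost q g W p y\<bar> \<le> \<epsilon>)"
proof -
  have bdd: "\<exists>m>0. \<forall>y\<in>K. norm (h y) \<le> m" if "locally_lipschitz_on \<Omega> h" for h :: "real ^ 'n \<Rightarrow> 'z::real_normed_vector"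
  proof -
    have "continuous_on K h" using locally_lipschitz_on_continuous[OF that] K(2) by (rule continuous_on_subset)
    then have "bounded (h ` K)" by (intro compact_imp_bounded compact_continuous_image K(1))
    then show ?thesis by (auto simp: bounded_pos)
  qed
  obtain kR where kR: "kR > 0" "\<And>(M :: real ^ 'n ^ 'n) v. norm (M *v v) \<le> norm M * norm v * kR"
    using bounded_bilinear.pos_bounded[OF bounded_bilinear_matrix_vector_mult] by blast
  obtain kS where kS: "kS > 0" "\<And>(M :: real ^ 'n ^ 'm) v. norm (M *v v) \<le> norm M * norm v * kS"
    using bounded_bilinear.pos_bounded[OF bounded_bilinear_matrix_vector_mult] by blast
  obtain kW where kW: "kW > 0" "\<And>u v. norm (u \<bullet> (W *v v)) \<le> norm u * norm v * kW"
    using bounded_bilinear.pos_bounded[OF bounded_bilinear_weight] by blast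
  obtain mR where mR: "mR > 0" "\<And>y. y \<in> K \<Longrightarrow> norm (Rmat g W y) \<le> mR"
    using bdd[OF Rmat_locally_lipschitz] by blast
  obtain mS where mS: "mS > 0" "\<And>y. y \<in> K \<Longrightarrow> norm (matrix_inv W ** transpose (g y)) \<le> mS"
    using bdd[OF gain_locally_lipschitz] by blast
  obtain mu where mu: "mu > 0" "\<And>y. y \<in> K \<Longrightarrow> norm (feedback g W p y) \<le> mu"
    using bdd[OF feedback_locally_lipschitz[OF p]] by blast
  define C where "C = mR * kR + mS * kS * (2 * mu + mS * kS) * kW"
  have "C > 0" using kR kS kW mR mS mu by (simp add: C_def add_pos_pos)
  \<comment> \<open>The bound 1 gives a uniform bound for the perturbed control, which makes the
    quadratic cost difference linear in \<open>\<delta>\<close>.\<close>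
  define \<delta> where "\<delta> = min 1 (\<epsilon> / C)"
  have \<delta>: "\<delta> > 0" "\<delta> \<le> 1" "C * \<delta> \<le> \<epsilon>"
    using \<open>C > 0\<close> \<open>\<epsilon> > 0\<close> by (auto simp: \<delta>_def min_def field_simps)
  have parts: "mR * kR * \<delta> \<le> C * \<delta>" "mS * kS * (2 * mu + mS * kS) * kW * \<delta> \<le> C * \<delta>"
    using kR kS kW mR mS mu \<delta> by (auto simp: C_def intro!: mult_right_mono)
  show ?thesis
  proof (intro exI[of _ \<delta>] conjI allI impI ballI \<delta>(1))
    fix p' y assume close: "\<forall>y\<in>K. norm (p' y - p y) \<le> \<delta>" and y: "y \<in> K"
    have d: "norm (p' y - p y) \<le> \<delta>" using close y by blast
    have "closed_loop f g W p' y - closed_loop f g W p y = - (Rmat g W y *v (p' y - p y))"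
      by (simp add: closed_loop_def matrix_vector_mult_diff_distrib)
    then have "norm (closed_loop f g W p' y - closed_loop f g W p y) \<le> norm (Rmat g W y) * norm (p' y - p y) * kR"
      using kR(2) by simp
    also have "\<dots> \<le> mR * \<delta> * kR"
      using d mR(2)[OF y] mR(1) kR(1) by (intro mult_right_mono mult_mono) auto
    finally show "norm (closed_loop f g W p' y - closed_loop f g W p y) \<le> \<epsilon>"
      using parts(1) \<delta>(3) by (simp add: mult_ac)
    let ?u = "feedback g W p y" and ?u' = "feedback g W p' y"
    have "?u' - ?u = - ((matrix_inv W ** transpose (g y)) *v (p' y - p y))"
      by (simp add: feedback_def matrix_vector_mult_diff_distrib)
    then have "norm (?u' - ?u) \<le> norm (matrix_inv W ** transpose (g y)) * norm (p' y - p y) * kS"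
      using kS(2) by simp
    also have "\<dots> \<le> mS * \<delta> * kS"
      using d mS(2)[OF y] mS(1) kS(1) by (intro mult_right_mono mult_mono) auto
    finally have du: "norm (?u' - ?u) \<le> mS * kS * \<delta>" by (simp add: mult_ac)
    also have "\<dots> \<le> mS * kS * 1" using mS kS \<delta> by (intro mult_left_mono) auto
    finally have u': "norm ?u' \<le> mu + mS * kS"
      using mu(2)[OF y] norm_triangle_sub[of ?u' ?u] by simp
    have "?u' \<bullet> (W *v ?u') - ?u \<bullet> (W *v ?u) = (?u' - ?u) \<bullet> (W *v ?u') + ?u \<bullet> (W *v (?u' - ?u))"
      by (simp add: bounded_bilinear.diff_left[OF bounded_bilinear_weight]
          bounded_bilinear.diff_right[OF bounded_bilinear_weight])
    then have "\<bar>?u' \<bullet> (W *v ?u') - ?u \<bullet> (W *v ?u)\<bar>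
        \<le> norm (?u' - ?u) * norm ?u' * kW + norm ?u * norm (?u' - ?u) * kW"
      using kW(2)[of "?u' - ?u" ?u'] kW(2)[of ?u "?u' - ?u"] unfolding real_norm_def by linarith
    also have "\<dots> \<le> (mS * kS * \<delta>) * (mu + mS * kS) * kW + mu * (mS * kS * \<delta>) * kW"
      using du u' mu(2)[OF y] mu(1) kW(1) mS(1) kS(1) \<delta>(1)
      by (intro add_mono mult_right_mono mult_mono) auto
    also have "\<dots> = mS * kS * (2 * mu + mS * kS) * kW * \<delta>" by (simp add: algebra_simps)
    finally have "\<bar>?u' \<bullet> (W *v ?u') - ?u \<bullet> (W *v ?u)\<bar> \<le> \<epsilon>"
      using parts(2) \<delta>(3) by linarith
    then show "\<bar>loop_cost q g W p' y - loop_cost q g W p y\<bar> \<le> \<epsilon>"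
      unfolding loop_cost_def by linarith
  qed
qed

text \<open>The field error consists of \<open>f y - A y\<close>, \<open>R(y) (p y - P y)\<close>
  and \<open>(R(y) - R(0)) P y\<close>. They are small by the expansion of \<open>f\<close>, by the
  choice of \<open>\<eta>\<close> and by continuity of \<open>R\<close>, and each receives
  \<open>\<kappa> / 3\<close>. The constants come before \<open>p\<close>, so they are common to the
  exact and the approximate costate.\<close>

lemma linearization_at_origin:
  fixes f :: "real ^ 'n \<Rightarrow> real ^ 'n" and q :: "real ^ 'n \<Rightarrow> real"
  assumes "open \<Omega>" "0 \<in> \<Omega>"
    and f: "(\<lambda>x. norm (f x - A *v x)) \<in> O[nhds 0](\<lambda>x. norm x ^ 2)"
    and q: "locally_lipschitz_on \<Omega> q" "q 0 = 0" and "\<kappa> > 0"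
  obtains \<eta> \<rho> c where "\<eta> > 0" "\<rho> > 0" "c \<ge> 0"
    "\<And>p y. norm y \<le> \<rho> \<Longrightarrow> norm (p y - P *v y) \<le> \<eta> * norm y \<Longrightarrow>
       norm (closed_loop f g W p y - (A - Rmat g W 0 ** P) *v y) \<le> \<kappa> * norm y \<and>
       \<bar>loop_cost q g W p y\<bar> \<le> c * norm y"
proof -
  obtain kR where kR: "kR > 0" "\<And>(M :: real ^ 'n ^ 'n) v. norm (M *v v) \<le> norm M * norm v * kR"
    using bounded_bilinear.pos_bounded[OF bounded_bilinear_matrix_vector_mult] by blast
  obtain kS where kS: "kS > 0" "\<And>(M :: real ^ 'n ^ 'm) v. norm (M *v v) \<le> norm M * norm v * kS"
    using bounded_bilinear.pos_bounded[OF bounded_bilinear_matrix_vector_mult] by blast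
  obtain kW where kW: "kW > 0" "\<And>u v. norm (u \<bullet> (W *v v)) \<le> norm u * norm v * kW"
    using bounded_bilinear.pos_bounded[OF bounded_bilinear_weight] by blast
  have cont: "(h \<longlongrightarrow> h 0) (nhds 0)" if "locally_lipschitz_on \<Omega> h" for h :: "real ^ 'n \<Rightarrow> 'z::real_normed_vector"
    using locally_lipschitz_on_continuous[OF that] \<open>open \<Omega>\<close> \<open>0 \<in> \<Omega>\<close>
    by (simp add: continuous_on_eq_continuous_at isCont_def tendsto_nhds_iff)
  have ev1: "\<forall>\<^sub>F y in nhds 0. norm (f y - A *v y) \<le> \<kappa> / 3 * norm y"
  proof -
    from f obtain C where C: "C > 0" "\<forall>\<^sub>F y in nhds 0. norm (f y - A *v y) \<le> C * (norm y)\<^sup>2"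
      by (auto simp: bigo_def)
    have "((\<lambda>y :: real ^ 'n. C * norm y) \<longlongrightarrow> C * norm (0 :: real ^ 'n)) (nhds 0)"
      by (intro tendsto_intros) (simp add: filterlim_ident)
    then have "\<forall>\<^sub>F y in nhds (0 :: real ^ 'n). C * norm y < \<kappa> / 3"
      by (rule order_tendstoD) (use \<open>\<kappa> > 0\<close> in simp)
    with C(2) show ?thesis
    proof eventually_elim
      case (elim y)
      have "C * norm y * norm y \<le> \<kappa> / 3 * norm y" using elim(2) by (intro mult_right_mono) auto
      with elim(1) show ?case by (simp add: power2_eq_square mult.assoc)
    qed
  qed
  define mR where "mR = norm (Rmat g W 0) + 1"
  have "mR > 0" by (simp add: mR_def add_nonneg_pos)
  have ev2: "\<forall>\<^sub>F y in nhds 0. norm (Rmat g W y) < mR"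
    by (rule order_tendstoD[OF tendsto_norm[OF cont[OF Rmat_locally_lipschitz]]]) (simp add: mR_def)
  define mS where "mS = norm (matrix_inv W ** transpose (g 0)) + 1"
  have "mS > 0" by (simp add: mS_def add_nonneg_pos)
  have ev3: "\<forall>\<^sub>F y in nhds 0. norm (matrix_inv W ** transpose (g y)) < mS"
    by (rule order_tendstoD[OF tendsto_norm[OF cont[OF gain_locally_lipschitz]]]) (simp add: mS_def)
  have ev4: "\<forall>\<^sub>F y in nhds 0. norm (Rmat g W y - Rmat g W 0) * (norm P * kR * kR) < \<kappa> / 3"
  proof (rule order_tendstoD)
    show "((\<lambda>y. norm (Rmat g W y - Rmat g W 0) * (norm P * kR * kR)) \<longlongrightarrow>
        norm (Rmat g W 0 - Rmat g W 0) * (norm P * kR * kR)) (nhds 0)"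
      by (intro tendsto_intros cont[OF Rmat_locally_lipschitz])
  qed (use \<open>\<kappa> > 0\<close> in simp)
  obtain Lq where ev5: "Lq \<ge> 0" "\<forall>\<^sub>F y in nhds 0. \<bar>q y\<bar> \<le> Lq * norm y"
  proof -
    from q(1) \<open>0 \<in> \<Omega>\<close> obtain r L where L: "r > 0" "L-lipschitz_on (cball 0 r \<inter> \<Omega>) q"
      unfolding locally_lipschitz_on_def by blast
    have "\<forall>\<^sub>F y in nhds 0. y \<in> ball 0 r \<inter> \<Omega>"
      using \<open>open \<Omega>\<close> \<open>0 \<in> \<Omega>\<close> \<open>r > 0\<close> by (intro eventually_nhds_in_open open_Int) auto
    then have "\<forall>\<^sub>F y in nhds 0. \<bar>q y\<bar> \<le> L * norm y"
    proof eventually_elim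
      case (elim y)
      then show ?case using lipschitz_on_normD[OF L(2), of y 0] \<open>0 \<in> \<Omega>\<close> L(1) q(2) by simp
    qed
    with lipschitz_on_nonneg[OF L(2)] that show thesis by blast
  qed
  have ev6: "\<forall>\<^sub>F y in nhds (0 :: real ^ 'n). norm y < 1"
    using eventually_nhds_ball[of 1 "0 :: real ^ 'n"] by simp
  from ev1 ev2 ev3 ev4 ev5(2) ev6 have "\<forall>\<^sub>F y in nhds 0. norm (f y - A *v y) \<le> \<kappa> / 3 * norm y \<and>
      norm (Rmat g W y) < mR \<and> norm (matrix_inv W ** transpose (g y)) < mS \<and>
      norm (Rmat g W y - Rmat g W 0) * (norm P * kR * kR) < \<kappa> / 3 \<and> \<bar>q y\<bar> \<le> Lq * norm y \<and> norm y < 1"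
    by eventually_elim simp
  then obtain d where d: "d > 0" "\<And>y. norm y < d \<Longrightarrow> norm (f y - A *v y) \<le> \<kappa> / 3 * norm y \<and>
      norm (Rmat g W y) < mR \<and> norm (matrix_inv W ** transpose (g y)) < mS \<and>
      norm (Rmat g W y - Rmat g W 0) * (norm P * kR * kR) < \<kappa> / 3 \<and> \<bar>q y\<bar> \<le> Lq * norm y \<and> norm y < 1"
    unfolding eventually_nhds_metric by auto
  \<comment> \<open>Solves \<open>mR * \<eta> * kR = \<kappa> / 3\<close>, the share of the middle
    term.\<close>
  define \<eta> where "\<eta> = \<kappa> / (3 * mR * kR)"
  have "\<eta> > 0" using \<open>\<kappa> > 0\<close> \<open>mR > 0\<close> kR by (simp add: \<eta>_def)
  define mp where "mp = norm P * kR + \<eta>"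
  have "mp > 0" using \<open>\<eta> > 0\<close> kR by (simp add: mp_def add_nonneg_pos)
  define mu where "mu = mS * mp * kS"
  have "mu > 0" using \<open>mS > 0\<close> \<open>mp > 0\<close> kS by (simp add: mu_def)
  define c where "c = Lq + 1 / 2 * (mu * mu * kW)"
  have "c \<ge> 0" using ev5(1) \<open>mu > 0\<close> kW by (simp add: c_def)
  have "norm (closed_loop f g W p y - (A - Rmat g W 0 ** P) *v y) \<le> \<kappa> * norm y \<and>
       \<bar>loop_cost q g W p y\<bar> \<le> c * norm y"
    if "norm y \<le> d / 2" and py: "norm (p y - P *v y) \<le> \<eta> * norm y" for p y
  proof -
    from that d(1) have "norm y < d" by simp
    note near = d(2)[OF this]
    let ?R = "Rmat g W y" and ?S = "Rmat g W 0"
    have Py: "norm (P *v y) \<le> norm P * kR * norm y" using kR(2)[of P y] by (simp add: mult_ac)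
    have "closed_loop f g W p y - (A - ?S ** P) *v y
        = (f y - A *v y) - ?R *v (p y - P *v y) - (?R - ?S) *v (P *v y)"
      unfolding closed_loop_def matrix_vector_mult_diff_rdistrib matrix_vector_mult_diff_distrib
        matrix_vector_mul_assoc[symmetric] by (simp add: algebra_simps)
    then have "norm (closed_loop f g W p y - (A - ?S ** P) *v y)
        \<le> norm (f y - A *v y) + norm (?R *v (p y - P *v y)) + norm ((?R - ?S) *v (P *v y))"
      using norm_triangle_ineq4[of "(f y - A *v y) - ?R *v (p y - P *v y)" "(?R - ?S) *v (P *v y)"]
        norm_triangle_ineq4[of "f y - A *v y" "?R *v (p y - P *v y)"] by simp
    also have "\<dots> \<le> \<kappa> / 3 * norm y + \<kappa> / 3 * norm y + \<kappa> / 3 * norm y"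
    proof (intro add_mono)
      show "norm (f y - A *v y) \<le> \<kappa> / 3 * norm y" using near by blast
      have "norm (?R *v (p y - P *v y)) \<le> norm ?R * norm (p y - P *v y) * kR" by (rule kR(2))
      also have "\<dots> \<le> mR * (\<eta> * norm y) * kR"
        using near py kR(1) \<open>mR > 0\<close> by (intro mult_right_mono mult_mono) auto
      also have "\<dots> = \<kappa> / 3 * norm y" using \<open>mR > 0\<close> kR(1) by (simp add: \<eta>_def)
      finally show "norm (?R *v (p y - P *v y)) \<le> \<kappa> / 3 * norm y" .
      have "norm ((?R - ?S) *v (P *v y)) \<le> norm (?R - ?S) * norm (P *v y) * kR" by (rule kR(2))
      also have "\<dots> \<le> norm (?R - ?S) * (norm P * kR * norm y) * kR"
        using Py kR(1) by (intro mult_right_mono mult_left_mono) auto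
      also have "\<dots> = norm (?R - ?S) * (norm P * kR * kR) * norm y" by (simp add: mult_ac)
      also have "\<dots> \<le> \<kappa> / 3 * norm y" using near by (intro mult_right_mono) auto
      finally show "norm ((?R - ?S) *v (P *v y)) \<le> \<kappa> / 3 * norm y" .
    qed
    finally have 1: "norm (closed_loop f g W p y - (A - ?S ** P) *v y) \<le> \<kappa> * norm y" by simp
    have "norm (p y) \<le> mp * norm y"
      using Py py norm_triangle_sub[of "p y" "P *v y"] by (simp add: mp_def distrib_right)
    have "norm (feedback g W p y) \<le> norm (matrix_inv W ** transpose (g y)) * norm (p y) * kS"
      using kS(2)[of "matrix_inv W ** transpose (g y)" "p y"] by (simp add: feedback_def)
    also have "\<dots> \<le> mS * (mp * norm y) * kS"
      using near \<open>norm (p y) \<le> mp * norm y\<close> kS(1) \<open>mS > 0\<close> by (intro mult_right_mono mult_mono) auto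
    finally have u: "norm (feedback g W p y) \<le> mu * norm y" by (simp add: mu_def mult_ac)
    let ?u = "feedback g W p y"
    have "\<bar>?u \<bullet> (W *v ?u)\<bar> \<le> norm ?u * norm ?u * kW" using kW(2)[of ?u ?u] by simp
    \<comment> \<open>One of the two factors \<open>norm y\<close> is bounded by 1: a linear bound
      on the cost suffices for exponentially small tails.\<close>
    also have "\<dots> \<le> (mu * norm y) * (mu * 1) * kW"
    proof (intro mult_right_mono mult_mono u)
      show "norm ?u \<le> mu * 1"
        by (rule order_trans[OF u]) (use near \<open>mu > 0\<close> in \<open>auto intro: mult_left_mono\<close>)
    qed (use \<open>mu > 0\<close> kW(1) in auto)
    finally have "\<bar>?u \<bullet> (W *v ?u)\<bar> \<le> mu * mu * kW * norm y" by (simp add: mult_ac)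
    then have 2: "\<bar>loop_cost q g W p y\<bar> \<le> c * norm y"
      using near unfolding loop_cost_def c_def distrib_right by linarith
    from 1 2 show ?thesis by blast
  qed
  with that[of \<eta> "d / 2" c] \<open>\<eta> > 0\<close> \<open>d > 0\<close> \<open>c \<ge> 0\<close> show thesis by simp
qed

end

section \<open>Regularity of the data and of the exact costate\<close>

lemma smooth_on_imp_locally_lipschitz:
  "open S \<Longrightarrow> smooth_on S f \<Longrightarrow> locally_lipschitz_on S f"
  using C1_imp_locally_lipschitz_on unfolding smooth_on_def by blast

text \<open>The coordinates of \<open>p\<close> are directional derivatives of \<open>V\<close>,
  hence continuously differentiable.\<close>

lemma gradient_of_C2_locally_lipschitz:
  fixes V :: "real ^ 'n::finite \<Rightarrow> real"
  assumes "open S" and V: "Ck_on 2 S V" and p: "\<And>x. x \<in> S \<Longrightarrow> GDERIV V x :> p x"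
  shows "locally_lipschitz_on S p"
proof (rule locally_lipschitz_on_euclidean)
  fix v :: "real ^ 'n"
  let ?d = "\<lambda>x. frechet_derivative V (at x) v"
  have eq: "p x \<bullet> v = ?d x" if "x \<in> S" for x
    using frechet_derivative_at[OF p[OF that, unfolded gderiv_def]] by (metis inner_commute)
  have "Ck_on (Suc 0) S ?d" using V by (simp add: numeral_2_eq_2)
  then have "locally_lipschitz_on S ?d" by (rule C1_imp_locally_lipschitz_on[OF \<open>open S\<close>])
  then show "locally_lipschitz_on S (\<lambda>x. p x \<bullet> v)"
    unfolding locally_lipschitz_on_def lipschitz_on_def by (simp add: eq)
qed

section \<open>Semiglobal approximation\<close>

text \<open>\<open>x\<close> is meant as the reference trajectory and \<open>J\<close> as its cost,
  whereas \<open>h\<close> is the running cost of the feedback that drives \<open>z\<close>.\<close>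

definition shadows_with_cost ::
  "(real ^ 'n::finite \<Rightarrow> real) \<Rightarrow> (real \<Rightarrow> real ^ 'n) \<Rightarrow> real \<Rightarrow> real \<Rightarrow> (real \<Rightarrow> real ^ 'n) \<Rightarrow> bool" where
  "shadows_with_cost h x J \<epsilon> z \<longleftrightarrow>
     (\<forall>t\<ge>0. norm (z t - x t) < \<epsilon>) \<and> decays_exponentially z \<and>
     (\<lambda>t. h (z t)) integrable_on {0..} \<and> \<bar>integral {0..} (\<lambda>t. h (z t)) - J\<bar> < \<epsilon>"

text \<open>For existence, the closed loop is replaced by a globally solvable field that agrees with
  it on \<open>K\<close>; the shadowing estimate keeps the solution in \<open>K\<close>, so it
  solves the closed loop as well. The bounds hold for every solution in \<Omega>, since the same
  estimate applies to it directly.\<close>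

lemma closed_loop_shadowing:
  fixes \<Omega> :: "(real ^ 'n::finite) set" and g :: "real ^ 'n \<Rightarrow> real ^ 'm::finite ^ 'n"
  assumes "open \<Omega>"
    and f: "locally_lipschitz_on \<Omega> f" and g: "locally_lipschitz_on \<Omega> g"
    and q: "locally_lipschitz_on \<Omega> q" and p: "locally_lipschitz_on \<Omega> p"
    and lyap: "lyapunov_form ((*v) M) B a" and b: "\<And>x y. norm (B x y) \<le> b * norm x * norm y" "b > 0"
    and \<kappa>: "2 * b * \<kappa> \<le> a" and \<rho>: "\<rho> > 0" "cball 0 \<rho> \<subseteq> \<Omega>" and "c \<ge> 0"
    and near: "\<And>p y. norm y \<le> \<rho> \<Longrightarrow> norm (p y - P *v y) \<le> \<eta> * norm y \<Longrightarrow>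
       norm (closed_loop f g W p y - M *v y) \<le> \<kappa> * norm y \<and> \<bar>loop_cost q g W p y\<bar> \<le> c * norm y"
    and pP: "\<And>y. norm y \<le> \<rho> \<Longrightarrow> norm (p y - P *v y) \<le> \<eta> * norm y"
    and x: "solution_from \<Omega> (closed_loop f g W p) x0 x" "(x \<longlongrightarrow> 0) at_top" and "\<epsilon> > 0"
  shows "\<exists>\<delta>>0. \<forall>p' y0. locally_lipschitz_on \<Omega> p' \<and> (\<forall>y\<in>\<Omega>. norm (p' y - p y) \<le> \<delta>) \<and>
      (\<forall>y. norm y \<le> \<rho> \<longrightarrow> norm (p' y - P *v y) \<le> \<eta> * norm y) \<and> norm (y0 - x0) \<le> \<delta> \<longrightarrow>
      (\<exists>z. solution_from \<Omega> (closed_loop f g W p') y0 z) \<and>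
      (\<forall>z. solution_from \<Omega> (closed_loop f g W p') y0 z \<longrightarrow>
         shadows_with_cost (loop_cost q g W p') x (integral {0..} (\<lambda>t. loop_cost q g W p (x t))) \<epsilon> z)"
proof -
  let ?F = "closed_loop f g W" and ?l = "loop_cost q g W"
  obtain K \<delta>0 where K: "compact K" "K \<subseteq> \<Omega>" "cball 0 \<rho> \<subseteq> K" "\<delta>0 > 0"
    and shadow: "\<And>G h y0 z. \<lbrakk>norm (y0 - x0) \<le> \<delta>0; \<And>y. y \<in> K \<Longrightarrow> norm (G y - ?F p y) \<le> \<delta>0;
        \<And>y. y \<in> K \<Longrightarrow> \<bar>h y - ?l p y\<bar> \<le> \<delta>0; continuous_on K h;
        \<And>y. norm y \<le> \<rho> \<Longrightarrow> norm (G y - M *v y) \<le> \<kappa> * norm y;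
        \<And>y. norm y \<le> \<rho> \<Longrightarrow> \<bar>h y\<bar> \<le> c * norm y;
        solution_from UNIV G y0 z\<rbrakk> \<Longrightarrow>
      (\<forall>t\<ge>0. z t \<in> K \<and> norm (z t - x t) < \<epsilon>) \<and> decays_exponentially z \<and>
      (\<lambda>t. h (z t)) integrable_on {0..} \<and>
      \<bar>integral {0..} (\<lambda>t. h (z t)) - integral {0..} (\<lambda>t. ?l p (x t))\<bar> < \<epsilon>"
    by (rule perturbed_trajectory[OF \<open>open \<Omega>\<close> closed_loop_locally_lipschitz[OF g f p]
          loop_cost_locally_lipschitz[OF g q p] lyap b \<kappa> \<rho> \<open>c \<ge> 0\<close>
          near[OF _ pP, THEN conjunct1] near[OF _ pP, THEN conjunct2] x \<open>\<epsilon> > 0\<close>]) blast+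
  obtain \<delta>1 where \<delta>1: "\<delta>1 > 0" "\<And>p'. (\<forall>y\<in>K. norm (p' y - p y) \<le> \<delta>1) \<Longrightarrow>
    (\<forall>y\<in>K. norm (?F p' y - ?F p y) \<le> \<delta>0 \<and> \<bar>?l p' y - ?l p y\<bar> \<le> \<delta>0)"
    using costate_perturbation[OF g K(1,2) p K(4), of f W q] by blast
  show ?thesis
  proof (intro exI[of _ "min \<delta>0 \<delta>1"] conjI allI impI)
    fix p' y0
    assume "locally_lipschitz_on \<Omega> p' \<and> (\<forall>y\<in>\<Omega>. norm (p' y - p y) \<le> min \<delta>0 \<delta>1) \<and>
      (\<forall>y. norm y \<le> \<rho> \<longrightarrow> norm (p' y - P *v y) \<le> \<eta> * norm y) \<and> norm (y0 - x0) \<le> min \<delta>0 \<delta>1"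
    then have p': "locally_lipschitz_on \<Omega> p'" "\<And>y. y \<in> \<Omega> \<Longrightarrow> norm (p' y - p y) \<le> \<delta>1"
      and p'P: "\<And>y. norm y \<le> \<rho> \<Longrightarrow> norm (p' y - P *v y) \<le> \<eta> * norm y" and y0: "norm (y0 - x0) \<le> \<delta>0"
      by auto
    have close: "norm (?F p' y - ?F p y) \<le> \<delta>0" "\<bar>?l p' y - ?l p y\<bar> \<le> \<delta>0" if "y \<in> K" for y
      using \<delta>1(2)[of p'] p'(2) K(2) that by (auto dest: subsetD)
    have cont: "continuous_on K (?l p')"
      using locally_lipschitz_on_continuous[OF loop_cost_locally_lipschitz[OF g q p'(1)]] K(2)
      by (rule continuous_on_subset)
    have near': "norm (?F p' y - M *v y) \<le> \<kappa> * norm y" "\<bar>?l p' y\<bar> \<le> c * norm y" if "norm y \<le> \<rho>" for y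
      using near[where p = p', OF that p'P[OF that]] by blast+
    \<comment> \<open>\<open>G\<close> is tied to the closed loop on \<open>K\<close> only, so that
      this covers the cutoff field as well as the closed loop itself.\<close>
    have main: "(\<forall>t\<ge>0. z t \<in> K) \<and> shadows_with_cost (?l p') x (integral {0..} (\<lambda>t. ?l p (x t))) \<epsilon> z"
      if G: "\<And>y. y \<in> K \<Longrightarrow> G y = ?F p' y" and z: "solution_from UNIV G y0 z" for G z
    proof -
      have "norm (G y - M *v y) \<le> \<kappa> * norm y" if "norm y \<le> \<rho>" for y
      proof -
        have "y \<in> K" using that K(3) by auto
        with near'(1)[OF that] show ?thesis by (simp add: G)
      qed
      with shadow[OF y0, of G "?l p'" z] close G near'(2) cont z
      show ?thesis unfolding shadows_with_cost_def by fastforce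
    qed
    have "K \<noteq> {}" using K(3) \<rho>(1) by (metis centre_in_cball empty_iff less_imp_le subsetD)
    then obtain G L m where G: "L-lipschitz_on UNIV G" "\<And>y. norm (G y) \<le> m" "\<And>y. y \<in> K \<Longrightarrow> G y = ?F p' y"
      using ex_lipschitz_cutoff[OF \<open>open \<Omega>\<close> closed_loop_locally_lipschitz[OF g f p'(1)] K(1,2)] by metis
    obtain z where z: "solution_from UNIV G y0 z" using ex_global_solution[OF G(1,2)] by blast
    have zK: "z t \<in> K" if "t \<ge> 0" for t using main[OF G(3) z] that by blast
    with z K(2) G(3) have "solution_from \<Omega> (?F p') y0 z" unfolding solution_from_def by auto
    then show "\<exists>z. solution_from \<Omega> (?F p') y0 z" by blast
    fix z assume "solution_from \<Omega> (?F p') y0 z"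
    then have "solution_from UNIV (?F p') y0 z" unfolding solution_from_def by auto
    then show "shadows_with_cost (?l p') x (integral {0..} (\<lambda>t. ?l p (x t))) \<epsilon> z"
      using main[of "?F p'" z] by blast
  qed (use K(4) \<delta>1(1) in auto)
qed

theorem theorem3p2:
  fixes \<Omega> :: "(real ^ 'n::finite) set"
    and f :: "real ^ 'n \<Rightarrow> real ^ 'n"
    and g :: "real ^ 'n \<Rightarrow> real ^ 'm::finite ^ 'n"
    and W :: "real ^ 'm ^ 'm"
    and p :: "real ^ 'n \<Rightarrow> real ^ 'n"
  assumes "open \<Omega>" and "connected \<Omega>" and "bounded \<Omega>" and "piecewise_smooth_boundary \<Omega>"
    and "0 \<in> \<Omega>"
    and "symmetric_matrix W" and "positive_definite_matrix W"
  shows "\<exists>C>0. \<forall>q A Q V P \<gamma>\<^sub>0 \<Psi>.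
    (\<forall>x\<in>\<Omega>. q x \<ge> 0) \<and>
    condition_C1 \<Omega> f g q A Q \<and>
    condition_C2 A (Rmat g W 0) Q \<and>
    semiglobal_solution \<Omega> f g q W V p \<and>
    stabilizing_riccati_solution A (Rmat g W 0) Q P \<and>
    \<gamma>\<^sub>0 > 0 \<and> compact \<Psi> \<and> \<Psi> \<subseteq> \<Omega> \<longrightarrow>
    (\<forall>\<epsilon>. 0 < \<epsilon> \<and> \<epsilon> < \<gamma>\<^sub>0 \<longrightarrow>
      (\<exists>\<delta>>0. \<exists>\<eta>>0. \<forall>pNN :: real ^ 'n \<Rightarrow> real ^ 'n.
        locally_lipschitz_on \<Omega> pNN \<and>
        (\<forall>x\<in>\<Omega>. norm (pNN x - p x) < \<delta>) \<and>
        (\<forall>x\<in>\<Omega>. norm x < \<gamma>\<^sub>0 \<longrightarrow> norm (pNN x - P *v x) \<le> \<eta> * norm x) \<longrightarrow>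
        (\<forall>x0\<in>\<Psi>.
          (\<exists>xNN. solution_from \<Omega> (closed_loop f g W pNN) x0 xNN) \<and>
          (\<forall>x xNN.
            solution_from \<Omega> (closed_loop f g W p) x0 x \<and>
            solution_from \<Omega> (closed_loop f g W pNN) x0 xNN \<longrightarrow>
              (\<forall>t>0. norm (xNN t - x t) < \<epsilon>) \<and>
              decays_exponentially xNN \<and> decays_exponentially x \<and>
              (let u = (\<lambda>t. feedback g W p (x t));
                   uNN = (\<lambda>t. feedback g W pNN (xNN t))
               in running_cost q W x u integrable_on {0..} \<and>
                  running_cost q W xNN uNN integrable_on {0..} \<and>
                  \<bar>cost q W xNN uNN - cost q W x u\<bar> < C * \<epsilon>)))))"
  (is "\<exists>C>0. \<forall>q A Q V P \<gamma>\<^sub>0 \<Psi>. ?hyps q A Q V P \<gamma>\<^sub>0 \<Psi> \<longrightarrow>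
    (\<forall>\<epsilon>. 0 < \<epsilon> \<and> \<epsilon> < \<gamma>\<^sub>0 \<longrightarrow>
      (\<exists>\<delta>>0. \<exists>\<eta>>0. \<forall>pNN. ?admissible P \<gamma>\<^sub>0 \<delta> \<eta> pNN \<longrightarrow> (\<forall>x0\<in>\<Psi>. ?goal q C \<epsilon> pNN x0)))")
proof (rule exI[of _ 1], intro conjI allI impI)
  fix q A Q V P and \<gamma>\<^sub>0 :: real and \<Psi> and \<epsilon> :: real
  assume hyps: "?hyps q A Q V P \<gamma>\<^sub>0 \<Psi>" and \<epsilon>: "0 < \<epsilon> \<and> \<epsilon> < \<gamma>\<^sub>0"
  let ?M = "A - Rmat g W 0 ** P"
  have "\<gamma>\<^sub>0 > 0" "compact \<Psi>" "\<Psi> \<subseteq> \<Omega>" using hyps by auto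
  have f: "locally_lipschitz_on \<Omega> f" and g: "locally_lipschitz_on \<Omega> g" and q: "locally_lipschitz_on \<Omega> q"
    using hyps \<open>open \<Omega>\<close> by (auto simp: condition_C1_def intro: smooth_on_imp_locally_lipschitz)
  have p: "locally_lipschitz_on \<Omega> p" and "p 0 = 0"
    using hyps gradient_of_C2_locally_lipschitz[OF \<open>open \<Omega>\<close>, of V p]
    by (auto simp: semiglobal_solution_def stabilizing_HJB_solution_def)
  have f0: "(\<lambda>x. norm (f x - A *v x)) \<in> O[nhds 0](\<lambda>x. norm x ^ 2)"
    using hyps by (auto simp: condition_C1_def)
  \<comment> \<open>The filter \<open>nhds 0\<close> contains the point 0 itself, where the cubic
    bound vanishes.\<close>
  have "q 0 = 0"
  proof -
    have "(\<lambda>x. q x - 1 / 2 * (x \<bullet> (Q *v x))) \<in> O[nhds 0](\<lambda>x. norm x ^ 3)"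
      using hyps by (auto simp: condition_C1_def)
    then obtain k where "\<forall>\<^sub>F x in nhds 0. norm (q x - 1 / 2 * (x \<bullet> (Q *v x))) \<le> k * norm (norm x ^ 3)"
      by (auto simp: bigo_def)
    from eventually_nhds_x_imp_x[OF this] show ?thesis by simp
  qed
  show "\<exists>\<delta>>0. \<exists>\<eta>>0. \<forall>pNN. ?admissible P \<gamma>\<^sub>0 \<delta> \<eta> pNN \<longrightarrow> (\<forall>x0\<in>\<Psi>. ?goal q 1 \<epsilon> pNN x0)"
  proof (cases "\<forall>\<eta>>0. \<exists>\<rho>>0. \<forall>y. norm y \<le> \<rho> \<longrightarrow> norm (p y - P *v y) \<le> \<eta> * norm y")
    case False
    text \<open>If \<^term>\<open>P\<close> were not the derivative of \<^term>\<open>p\<close> at the origin, the two approximation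
      hypotheses would contradict each other at a suitable point for small tolerances.\<close>
    then obtain \<eta> where \<eta>: "\<eta> > 0" "\<And>\<rho>. \<rho> > 0 \<Longrightarrow> \<exists>y. norm y \<le> \<rho> \<and> norm (p y - P *v y) > \<eta> * norm y"
      by (auto simp: not_le)
    obtain r where r: "r > 0" "ball 0 r \<subseteq> \<Omega>" using \<open>open \<Omega>\<close> \<open>0 \<in> \<Omega>\<close> by (meson openE)
    obtain y where y: "norm y \<le> min (r / 2) (\<gamma>\<^sub>0 / 2)" "norm (p y - P *v y) > \<eta> * norm y"
      using \<eta>(2)[of "min (r / 2) (\<gamma>\<^sub>0 / 2)"] r(1) \<open>\<gamma>\<^sub>0 > 0\<close> by auto
    have "y \<noteq> 0" using y(2) \<open>p 0 = 0\<close> by auto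
    have "y \<in> \<Omega>" "norm y < \<gamma>\<^sub>0" using y(1) r \<open>\<gamma>\<^sub>0 > 0\<close> by (auto intro!: subsetD[OF r(2)])
    have "\<not> ?admissible P \<gamma>\<^sub>0 (\<eta> / 2 * norm y) (\<eta> / 2) pNN" for pNN
    proof
      assume "?admissible P \<gamma>\<^sub>0 (\<eta> / 2 * norm y) (\<eta> / 2) pNN"
      then have "norm (pNN y - p y) < \<eta> / 2 * norm y" "norm (pNN y - P *v y) \<le> \<eta> / 2 * norm y"
        using \<open>y \<in> \<Omega>\<close> \<open>norm y < \<gamma>\<^sub>0\<close> by blast+
      then have "norm (p y - P *v y) < \<eta> / 2 * norm y + \<eta> / 2 * norm y"
        using norm_triangle_ineq4[of "pNN y - P *v y" "pNN y - p y"] by (simp add: algebra_simps)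
      with y(2) show False by (simp add: field_simps)
    qed
    moreover have "\<eta> / 2 * norm y > 0" "\<eta> / 2 > 0" using \<eta>(1) \<open>y \<noteq> 0\<close> by auto
    ultimately show ?thesis by blast
  next
    case True
    obtain B a where lyap: "lyapunov_form ((*v) ?M) B a"
      using hurwitz_imp_lyapunov_form[of ?M] hyps by (auto simp: stabilizing_riccati_solution_def)
    then have "a > 0" "bounded_bilinear B" by (auto simp: lyapunov_form_def)
    from bounded_bilinear.pos_bounded[OF this(2)] obtain b where b: "b > 0" "\<And>x y. norm (B x y) \<le> b * norm x * norm y"
      by (metis mult.commute mult.assoc)
    \<comment> \<open>The largest relative error of the linearization that costs no more than half
      of the decay rate.\<close>
    define \<kappa> where "\<kappa> = a / (2 * b)"
    have \<kappa>: "\<kappa> > 0" "2 * b * \<kappa> \<le> a" using \<open>a > 0\<close> b(1) by (auto simp: \<kappa>_def)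
    obtain \<eta> \<rho>1 c where \<eta>: "\<eta> > 0" "\<rho>1 > 0" "c \<ge> 0"
      "\<And>p y. norm y \<le> \<rho>1 \<Longrightarrow> norm (p y - P *v y) \<le> \<eta> * norm y \<Longrightarrow>
         norm (closed_loop f g W p y - ?M *v y) \<le> \<kappa> * norm y \<and> \<bar>loop_cost q g W p y\<bar> \<le> c * norm y"
      using linearization_at_origin[OF g \<open>open \<Omega>\<close> \<open>0 \<in> \<Omega>\<close> f0 q \<open>q 0 = 0\<close> \<kappa>(1), of P W] by metis
    obtain \<rho>2 where \<rho>2: "\<rho>2 > 0" "\<And>y. norm y \<le> \<rho>2 \<Longrightarrow> norm (p y - P *v y) \<le> \<eta> * norm y"
      using True \<eta>(1) by blast
    obtain r where r: "r > 0" "cball 0 r \<subseteq> \<Omega>" using \<open>open \<Omega>\<close> \<open>0 \<in> \<Omega>\<close> by (meson open_contains_cball)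
    \<comment> \<open>The entry \<open>\<gamma>\<^sub>0 / 2\<close> puts the closed ball inside the
      open region where (b) is assumed.\<close>
    define \<rho> where "\<rho> = min (min \<rho>1 \<rho>2) (min r (\<gamma>\<^sub>0 / 2))"
    have \<rho>: "\<rho> > 0" "\<rho> \<le> \<rho>1" "\<rho> \<le> \<rho>2" "\<rho> \<le> r" "\<rho> < \<gamma>\<^sub>0"
      using \<eta>(2) \<rho>2(1) r(1) \<open>\<gamma>\<^sub>0 > 0\<close> by (auto simp: \<rho>_def)
    then have \<rho>\<Omega>: "cball 0 \<rho> \<subseteq> \<Omega>" using r(2) by (meson cball_subset_cball_iff order_trans subset_cball)
    have pP: "norm (p y - P *v y) \<le> \<eta> * norm y" if "norm y \<le> \<rho>" for y
      using \<rho>2(2)[of y] that \<rho> by linarith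
    \<comment> \<open>One radius for both the displacement of the start and the error of the
      costate; \<open>\<epsilon> / 2\<close> leaves room for the triangle inequality.\<close>
    define good where "good = (\<lambda>x0 x \<delta>. \<forall>p' y0. locally_lipschitz_on \<Omega> p' \<and> (\<forall>y\<in>\<Omega>. norm (p' y - p y) \<le> \<delta>) \<and>
      (\<forall>y. norm y \<le> \<rho> \<longrightarrow> norm (p' y - P *v y) \<le> \<eta> * norm y) \<and> norm (y0 - x0) \<le> \<delta> \<longrightarrow>
      (\<exists>z. solution_from \<Omega> (closed_loop f g W p') y0 z) \<and>
      (\<forall>z. solution_from \<Omega> (closed_loop f g W p') y0 z \<longrightarrow>
         shadows_with_cost (loop_cost q g W p') x (integral {0..} (\<lambda>t. loop_cost q g W p (x t))) (\<epsilon> / 2) z))"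
    have "\<exists>x \<delta>. \<delta> > 0 \<and> good x0 x \<delta>" if "x0 \<in> \<Omega>" for x0
    proof -
      obtain x where x: "solution_from \<Omega> (closed_loop f g W p) x0 x" "(x \<longlongrightarrow> 0) at_top"
        using hyps \<open>x0 \<in> \<Omega>\<close> unfolding semiglobal_solution_def by blast
      have near: "norm (closed_loop f g W p y - ?M *v y) \<le> \<kappa> * norm y \<and> \<bar>loop_cost q g W p y\<bar> \<le> c * norm y"
        if "norm y \<le> \<rho>" "norm (p y - P *v y) \<le> \<eta> * norm y" for p y
        using that \<rho>(2) by (intro \<eta>(4)) auto
      have "\<epsilon> / 2 > 0" using \<epsilon> by simp
      from closed_loop_shadowing[OF \<open>open \<Omega>\<close> f g q p lyap b(2,1) \<kappa>(2) \<rho>(1) \<rho>\<Omega> \<eta>(3) near pP x this]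
      show ?thesis unfolding good_def by blast
    qed
    then have "\<forall>x0\<in>\<Omega>. \<exists>xd. snd xd > 0 \<and> good x0 (fst xd) (snd xd)" by auto
    then obtain xd where xd: "\<forall>x0\<in>\<Omega>. snd (xd x0) > 0 \<and> good x0 (fst (xd x0)) (snd (xd x0))"
      by (rule bchoice[THEN exE])
    define X d where "X = (\<lambda>x0. fst (xd x0))" and "d = (\<lambda>x0. snd (xd x0))"
    have d: "d x0 > 0" and good: "good x0 (X x0) (d x0)" if "x0 \<in> \<Omega>" for x0
      using xd that by (auto simp: X_def d_def)
    have cover: "\<Psi> \<subseteq> (\<Union>x0\<in>\<Psi>. ball x0 (d x0))"
    proof
      fix y assume "y \<in> \<Psi>"
      then have "y \<in> ball y (d y)" using d \<open>\<Psi> \<subseteq> \<Omega>\<close> by (simp add: subset_iff)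
      with \<open>y \<in> \<Psi>\<close> show "y \<in> (\<Union>x0\<in>\<Psi>. ball x0 (d x0))" by blast
    qed
    obtain D where D: "D \<subseteq> \<Psi>" "finite D" "\<Psi> \<subseteq> (\<Union>x0\<in>D. ball x0 (d x0))"
      by (rule compactE_image[OF \<open>compact \<Psi>\<close> open_ball cover])
    \<comment> \<open>The inserted 1 covers an empty \<open>D\<close>.\<close>
    define \<delta> where "\<delta> = Min (insert 1 (d ` D))"
    have \<delta>: "\<delta> > 0" "\<And>x0. x0 \<in> D \<Longrightarrow> \<delta> \<le> d x0"
      using D d \<open>\<Psi> \<subseteq> \<Omega>\<close> by (auto simp: \<delta>_def)
    show ?thesis
    proof (rule exI[of _ \<delta>], rule conjI[OF \<delta>(1)], rule exI[of _ \<eta>], rule conjI[OF \<eta>(1)], intro allI impI ballI)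
      fix pNN y0 assume adm: "?admissible P \<gamma>\<^sub>0 \<delta> \<eta> pNN" and "y0 \<in> \<Psi>"
      then obtain x0 where x0: "x0 \<in> D" "y0 \<in> ball x0 (d x0)" using D(3) by blast
      then have y0: "norm (y0 - x0) \<le> d x0" by (simp add: dist_norm norm_minus_commute)
      have "x0 \<in> \<Omega>" using x0 D \<open>\<Psi> \<subseteq> \<Omega>\<close> by blast
      have "locally_lipschitz_on \<Omega> pNN" "\<forall>y\<in>\<Omega>. norm (pNN y - p y) \<le> d x0"
        "\<forall>y. norm y \<le> \<rho> \<longrightarrow> norm (pNN y - P *v y) \<le> \<eta> * norm y"
        using adm \<delta>(2)[OF x0(1)] \<rho> \<rho>\<Omega> by (force simp: subset_iff)+
      with good[OF \<open>x0 \<in> \<Omega>\<close>, unfolded good_def] y0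
      have NN: "\<exists>z. solution_from \<Omega> (closed_loop f g W pNN) y0 z"
        "\<And>z. solution_from \<Omega> (closed_loop f g W pNN) y0 z \<Longrightarrow>
           shadows_with_cost (loop_cost q g W pNN) (X x0) (integral {0..} (\<lambda>t. loop_cost q g W p (X x0 t))) (\<epsilon> / 2) z"
        by blast+
      \<comment> \<open>With \<open>p' = p\<close> the exact trajectory from \<open>y0\<close>
        shadows the same reference trajectory.\<close>
      have "\<forall>y\<in>\<Omega>. norm (p y - p y) \<le> d x0" using d[OF \<open>x0 \<in> \<Omega>\<close>] by simp
      with good[OF \<open>x0 \<in> \<Omega>\<close>, unfolded good_def] y0 p pP
      have ref: "\<And>z. solution_from \<Omega> (closed_loop f g W p) y0 z \<Longrightarrow>
           shadows_with_cost (loop_cost q g W p) (X x0) (integral {0..} (\<lambda>t. loop_cost q g W p (X x0 t))) (\<epsilon> / 2) z"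
        by blast
      show "?goal q 1 \<epsilon> pNN y0"
      proof (intro conjI NN(1) allI impI)
        fix x xNN
        assume sols: "solution_from \<Omega> (closed_loop f g W p) y0 x \<and> solution_from \<Omega> (closed_loop f g W pNN) y0 xNN"
        note s = NN(2)[OF sols[THEN conjunct2], unfolded shadows_with_cost_def]
          ref[OF sols[THEN conjunct1], unfolded shadows_with_cost_def]
        show "norm (xNN t - x t) < \<epsilon>" if "t > 0" for t
        proof -
          have "norm (xNN t - X x0 t) < \<epsilon> / 2" "norm (x t - X x0 t) < \<epsilon> / 2" using s that by auto
          then show ?thesis using norm_triangle_ineq4[of "xNN t - X x0 t" "x t - X x0 t"] by simp
        qed
        show "decays_exponentially xNN" "decays_exponentially x" using s by blast+
        show "let u = (\<lambda>t. feedback g W p (x t)); uNN = (\<lambda>t. feedback g W pNN (xNN t))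
          in running_cost q W x u integrable_on {0..} \<and> running_cost q W xNN uNN integrable_on {0..} \<and>
             \<bar>cost q W xNN uNN - cost q W x u\<bar> < 1 * \<epsilon>"
        proof -
          \<comment> \<open>Both costs lie within \<open>\<epsilon> / 2\<close> of the cost of the
            reference trajectory.\<close>
          have "\<bar>integral {0..} (\<lambda>t. loop_cost q g W pNN (xNN t)) - integral {0..} (\<lambda>t. loop_cost q g W p (x t))\<bar> < 1 * \<epsilon>"
            using s by linarith
          with s show ?thesis unfolding Let_def cost_def running_cost_feedback by blast
        qed
      qed
    qed
  qed
qed simp

end
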